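(* Let $\Omega=\mathbb{R}^2$ or $\Omega=\mathbb{T}^2$, let $k\ge4$, let $\rho_2>\rho_1\ge0$, and let $f_0\in H^k(\Omega)$. Let $f\in C^1([0,T];H^k(\Omega))$ be the solution of the two-dimensional interface equation $$ f_t(x,t)=\frac{\rho_2-\rho_1}{4\pi}\,PV\!\int_{\mathbb{R}^2}\frac{\big(\nabla f(x,t)-\nabla f(x-y,t)\big)\cdot y}{\big[|y|^2+(f(x,t)-f(x-y,t))^2\big]^{3/2}}\,dy,\qquad f(x,0)=f_0(x),\ x\in\Omega. $$ Then for all $t\in[0,T]$, $\|f(\cdot,t)\|_{L^\infty(\Omega)}\le\|f_0\|_{L^\infty(\Omega)}$.
   Context: $\mathbb{T}^2=(\mathbb{R}/2\pi\mathbb{Z})^2$, periodic functions regarded as functions on $\mathbb{R}^2$; $PV$ denotes the principal value at infinity, $\lim_{R\to\infty}\int_{|y|\le R}$. $f$ describes the interface $x_3=f(x_1,x_2,t)$ between two incompressible fluids of densities $\rho_1$ (above) and $\rho_2$ (below) moving by Darcy's law. *)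

theory Defs
  imports "HOL-Analysis.Analysis" "HOL-Probability.Essential_Supremum"
begin

datatype domain = Plane | Torus

text \<open>Points of R^2 are pairs of reals. Functions on T^2 are regarded as
  2pi-periodic functions on R^2; integrals over T^2 are over the fundamental
  square [0,2pi]^2.\<close>

definition dom_set :: "domain \<Rightarrow> (real \<times> real) set" where
  "dom_set D = (case D of Plane \<Rightarrow> UNIV | Torus \<Rightarrow> {0..2*pi} \<times> {0..2*pi})"

definition admissible :: "domain \<Rightarrow> (real \<times> real \<Rightarrow> real) \<Rightarrow> bool" where
  "admissible D g = (case D of Plane \<Rightarrow> True
     | Torus \<Rightarrow> (\<forall>a b. g (a + 2*pi, b) = g (a, b) \<and> g (a, b + 2*pi) = g (a, b)))"

definition axis2 :: "nat \<Rightarrow> real \<times> real" where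
  "axis2 i = (if i = 0 then (1, 0) else (0, 1))"

definition pd :: "nat \<Rightarrow> (real \<times> real \<Rightarrow> real) \<Rightarrow> real \<times> real \<Rightarrow> real" where
  "pd i g x = deriv (\<lambda>s. g (x + s *\<^sub>R axis2 i)) 0"

fun pd_list :: "nat list \<Rightarrow> (real \<times> real \<Rightarrow> real) \<Rightarrow> real \<times> real \<Rightarrow> real" where
  "pd_list [] g = g"
| "pd_list (i # is) g = pd i (pd_list is g)"

definition Dmulti :: "nat \<times> nat \<Rightarrow> (real \<times> real \<Rightarrow> real) \<Rightarrow> real \<times> real \<Rightarrow> real" where
  "Dmulti \<alpha> g = ((pd 0) ^^ fst \<alpha>) (((pd 1) ^^ snd \<alpha>) g)"

definition smooth2 :: "(real \<times> real \<Rightarrow> real) \<Rightarrow> bool" where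
  "smooth2 \<phi> = (\<forall>is x. pd_list is \<phi> differentiable (at x))"

definition test_fun :: "(real \<times> real \<Rightarrow> real) \<Rightarrow> bool" where
  "test_fun \<phi> = (smooth2 \<phi> \<and> bounded {x. \<phi> x \<noteq> 0})"

definition has_weak_deriv ::
  "nat \<times> nat \<Rightarrow> (real \<times> real \<Rightarrow> real) \<Rightarrow> (real \<times> real \<Rightarrow> real) \<Rightarrow> bool" where
  "has_weak_deriv \<alpha> g h =
     (h \<in> borel_measurable lborel \<and>
      (\<forall>\<phi>. test_fun \<phi> \<longrightarrow>
         integrable lborel (\<lambda>x. g x * Dmulti \<alpha> \<phi> x) \<and>
         integrable lborel (\<lambda>x. h x * \<phi> x) \<and>
         (\<integral>x. g x * Dmulti \<alpha> \<phi> x \<partial>lborel) =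
           (-1) ^ (fst \<alpha> + snd \<alpha>) * (\<integral>x. h x * \<phi> x \<partial>lborel)))"

definition weak_deriv :: "nat \<times> nat \<Rightarrow> (real \<times> real \<Rightarrow> real) \<Rightarrow> real \<times> real \<Rightarrow> real" where
  "weak_deriv \<alpha> g = (SOME h. has_weak_deriv \<alpha> g h)"

definition in_Hk :: "domain \<Rightarrow> nat \<Rightarrow> (real \<times> real \<Rightarrow> real) \<Rightarrow> bool" where
  "in_Hk D k g =
     (admissible D g \<and> g \<in> borel_measurable lborel \<and>
      (\<forall>\<alpha>. fst \<alpha> + snd \<alpha> \<le> k \<longrightarrow>
         (\<exists>h. has_weak_deriv \<alpha> g h \<and> set_integrable lborel (dom_set D) (\<lambda>x. (h x)\<^sup>2))))"

definition Hk_norm :: "domain \<Rightarrow> nat \<Rightarrow> (real \<times> real \<Rightarrow> real) \<Rightarrow> real" where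
  "Hk_norm D k g =
     sqrt (\<Sum>\<alpha>\<in>{\<alpha>. fst \<alpha> + snd \<alpha> \<le> k}.
             (LINT x:dom_set D|lborel. (weak_deriv \<alpha> g x)\<^sup>2))"

definition C1_Hk :: "domain \<Rightarrow> nat \<Rightarrow> real \<Rightarrow> (real \<Rightarrow> real \<times> real \<Rightarrow> real) \<Rightarrow> bool" where
  "C1_Hk D k T f =
     ((\<forall>t\<in>{0..T}. in_Hk D k (f t)) \<and>
      (\<exists>f'. (\<forall>t\<in>{0..T}. in_Hk D k (f' t)) \<and>
         (\<forall>t\<in>{0..T}. ((\<lambda>s. Hk_norm D k (\<lambda>x. (f s x - f t x) / (s - t) - f' t x))
                         \<longlongrightarrow> 0) (at t within {0..T})) \<and>
         (\<forall>t\<in>{0..T}. ((\<lambda>s. Hk_norm D k (\<lambda>x. f' s x - f' t x))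
                         \<longlongrightarrow> 0) (at t within {0..T}))))"

definition Linf_norm :: "domain \<Rightarrow> (real \<times> real \<Rightarrow> real) \<Rightarrow> ereal" where
  "Linf_norm D g = esssup (restrict_space lborel (dom_set D)) (\<lambda>x. ereal \<bar>g x\<bar>)"

definition grad2 :: "(real \<times> real \<Rightarrow> real) \<Rightarrow> real \<times> real \<Rightarrow> real \<times> real" where
  "grad2 g x = (pd 0 g x, pd 1 g x)"

definition kernel :: "(real \<times> real \<Rightarrow> real) \<Rightarrow> real \<times> real \<Rightarrow> real \<times> real \<Rightarrow> real" where
  "kernel g x y = ((grad2 g x - grad2 g (x - y)) \<bullet> y) /
                  ((norm y)\<^sup>2 + (g x - g (x - y))\<^sup>2) powr (3/2)"

definition has_PV :: "(real \<times> real \<Rightarrow> real) \<Rightarrow> real \<Rightarrow> bool" where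
  "has_PV F L =
     ((\<forall>R. set_integrable lborel (cball 0 R) F) \<and>
      ((\<lambda>R. LINT y:cball 0 R|lborel. F y) \<longlongrightarrow> L) at_top)"

text \<open>f solves f_t = (rho2-rho1)/(4pi) PV int ... on [0,T], pointwise in x
  (f(.,t) being the regular, differentiable representative).\<close>
definition interface_solution ::
  "real \<Rightarrow> real \<Rightarrow> real \<Rightarrow> (real \<Rightarrow> real \<times> real \<Rightarrow> real) \<Rightarrow> bool" where
  "interface_solution \<rho>1 \<rho>2 T f =
     (\<forall>t\<in>{0..T}. \<forall>x.
        f t differentiable (at x) \<and>
        (\<exists>v. has_PV (kernel (f t) x) v \<and>
             ((\<lambda>s. f s x) has_real_derivative ((\<rho>2 - \<rho>1) / (4 * pi) * v)) (at t within {0..T})))"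

end

theory Submission
  imports Defs
begin

text \<open>Let \<open>x\<close> be a maximum point of \<open>f t\<close>. The gradient vanishes there, and along each ray the kernel
  is the derivative of a function with the right sign plus a term with the right sign, so its integral
  over every ball, hence the principal value and \<open>f\<^sub>t\<close>, is at most 0; dually at minimum points.
  A first-time argument for \<open>f t x < K + \<epsilon> (1 + t)\<close> then bounds \<open>f\<close> by its initial supremum. It needs
  that a positive supremum is attained and that \<open>f\<close> is locally Lipschitz in time uniformly in space; both
  come from the embedding of \<open>H\<^sup>2\<close> into \<open>L\<^sup>\<infinity>\<close>, obtained by testing the weak derivatives with a
  mollifier written as a sum of derivatives of bounded functions.\<close>

section \<open>Smooth functions and test functions\<close>

text \<open>The equation holds pointwise in \<open>x\<close> and by itself gives no uniform control
  in time: a supremum could grow although no fixed point is seen to climb to it. The Lipschitz bound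
  uniform in \<open>x\<close> closes this gap by carrying near-violations at times just after the
  first bad time back to that time. The sign of the time derivative at a maximum is only weak; the
  strictly increasing slack turns it into a contradiction without differentiating the supremum in
  time. Positive suprema suffice because the bound \<open>K\<close> is nonnegative, and on the plane
  a supremum of 0 may be approached only at infinity. The kernel is singular at the origin. Along a
  ray this singularity becomes a boundary value at \<open>l = 0\<close>, which the vanishing
  gradient sends to 0. Plane and torus share one Sobolev inequality on boxes of fixed size, because
  test functions live on the whole plane while the norm on the torus integrates over the fundamental
  square only.\<close>

fun ndiff :: "nat \<Rightarrow> (real \<Rightarrow> real) \<Rightarrow> bool" where
  "ndiff 0 f = True"
| "ndiff (Suc n) f = (\<exists>f'. (\<forall>x. (f has_real_derivative f' x) (at x)) \<and> ndiff n f')"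

text \<open>The existential witnesses in \<open>ndiff\<close> make the closure rules inductions on
  the order; the return to \<open>deriv\<close>, in whose terms \<open>pd\<close> is defined, is
  made in \<open>smooth1_deriv\<close>.\<close>

definition smooth1 :: "(real \<Rightarrow> real) \<Rightarrow> bool" where
  "smooth1 f \<longleftrightarrow> (\<forall>n. ndiff n f)"

lemma ndiff_SucD: "ndiff (Suc n) f \<Longrightarrow> ndiff n f"
proof (induction n arbitrary: f)
  case (Suc n)
  then obtain f' where "\<forall>x. (f has_real_derivative f' x) (at x)" "ndiff (Suc n) f'" by auto
  with Suc.IH show ?case by auto
qed simp

lemma ndiff_add: "ndiff n f \<Longrightarrow> ndiff n g \<Longrightarrow> ndiff n (\<lambda>x. f x + g x)"
proof (induction n arbitrary: f g)
  case (Suc n)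
  then obtain f' g' where "\<forall>x. (f has_real_derivative f' x) (at x)" "ndiff n f'"
    "\<forall>x. (g has_real_derivative g' x) (at x)" "ndiff n g'" by auto
  with Suc.IH[of f' g'] show ?case
    by (auto intro!: exI[of _ "\<lambda>x. f' x + g' x"] derivative_eq_intros)
qed simp

lemma ndiff_mult: "ndiff n f \<Longrightarrow> ndiff n g \<Longrightarrow> ndiff n (\<lambda>x. f x * g x)"
proof (induction n arbitrary: f g)
  case (Suc n)
  then obtain f' g' where f: "\<forall>x. (f has_real_derivative f' x) (at x)" "ndiff n f'"
    and g: "\<forall>x. (g has_real_derivative g' x) (at x)" "ndiff n g'" by auto
  have "ndiff n (\<lambda>x. f' x * g x + f x * g' x)"
    by (intro ndiff_add Suc.IH f g ndiff_SucD[OF Suc.prems(1)] ndiff_SucD[OF Suc.prems(2)])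
  moreover have "((\<lambda>x. f x * g x) has_real_derivative (f' x * g x + f x * g' x)) (at x)" for x
    using f g by (auto intro!: derivative_eq_intros)
  ultimately show ?case by (auto intro!: exI[of _ "\<lambda>x. f' x * g x + f x * g' x"])
qed simp

lemma ndiff_const: "ndiff n (\<lambda>x. c)"
  by (induction n arbitrary: c) (auto intro!: exI[of _ "\<lambda>x. 0"])

lemma ndiff_affine: "ndiff n f \<Longrightarrow> ndiff n (\<lambda>x. f (a * x + b))"
proof (induction n arbitrary: f)
  case (Suc n)
  then obtain f' where f: "\<And>x. (f has_real_derivative f' x) (at x)" "ndiff n f'" by auto
  have "ndiff n (\<lambda>x. f' (a * x + b) * a)"
    by (intro ndiff_mult ndiff_const Suc.IH f)
  moreover have "((\<lambda>x. f (a * x + b)) has_real_derivative (f' (a * x + b) * a)) (at x)" for x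
    by (rule DERIV_chain'[where f = "\<lambda>x. a * x + b"]) (auto intro!: derivative_eq_intros f)
  ultimately show ?case by (auto intro!: exI[of _ "\<lambda>x. f' (a * x + b) * a"])
qed simp

lemma smooth1_intros:
  "smooth1 (\<lambda>x. c)"
  "smooth1 f \<Longrightarrow> smooth1 g \<Longrightarrow> smooth1 (\<lambda>x. f x + g x)"
  "smooth1 f \<Longrightarrow> smooth1 g \<Longrightarrow> smooth1 (\<lambda>x. f x * g x)"
  "smooth1 f \<Longrightarrow> smooth1 (\<lambda>x. f (a * x + b))"
  by (auto simp: smooth1_def intro: ndiff_const ndiff_add ndiff_mult ndiff_affine)

lemma smooth1_diff:
  assumes "smooth1 f" "smooth1 g" shows "smooth1 (\<lambda>x. f x - g x)"
  using smooth1_intros(2)[OF assms(1) smooth1_intros(3)[OF smooth1_intros(1)[of "-1"] assms(2)]]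
  by simp

lemma smooth1_deriv:
  assumes "smooth1 f"
  shows "(f has_real_derivative deriv f x) (at x)" "smooth1 (deriv f)"
proof -
  have *: "\<exists>f'. (\<forall>x. (f has_real_derivative f' x) (at x)) \<and> ndiff n f'" for n
    using assms unfolding smooth1_def by (metis ndiff.simps(2))
  show "(f has_real_derivative deriv f x) (at x)"
    using *[of 0] DERIV_imp_deriv by metis
  show "smooth1 (deriv f)"
    unfolding smooth1_def
  proof
    fix n
    obtain f' where f: "\<forall>x. (f has_real_derivative f' x) (at x)" "ndiff n f'" using *[of n] by blast
    then have "deriv f = f'" by (auto intro: DERIV_imp_deriv)
    with f show "ndiff n (deriv f)" by simp
  qed
qed

lemma smooth1_antideriv:
  assumes "smooth1 f" "\<And>x. (F has_real_derivative f x) (at x)"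
  shows "smooth1 F"
  unfolding smooth1_def
proof
  fix n show "ndiff n F"
    using assms by (cases n) (auto simp: smooth1_def)
qed

section \<open>A smooth step from the flat function exp(-1/x)\<close>

definition expinv :: "nat \<Rightarrow> real \<Rightarrow> real" where
  "expinv k x = (if x > 0 then (1/x)^k * exp (-(1/x)) else 0)"

lemma expinv_tendsto_0: "(expinv k \<longlongrightarrow> 0) (at_right 0)"
proof -
  have "((\<lambda>x. (inverse x)^k / exp (inverse x)) \<longlongrightarrow> 0) (at_right (0::real))"
    by (rule filterlim_compose[OF tendsto_power_div_exp_0 filterlim_inverse_at_top_right])
  then show ?thesis
    by (rule Lim_transform_eventually)
       (auto simp: expinv_def eventually_at_filter exp_minus field_simps)
qed

lemma expinv_has_derivative:
  "(expinv k has_real_derivative expinv (k + 2) x - real k * expinv (k + 1) x) (at x)"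
proof -
  consider "x > 0" | "x < 0" | "x = 0" by linarith
  then show ?thesis
  proof cases
    case 1
    have "((\<lambda>x. (1/x)^k * exp (-(1/x))) has_real_derivative
        expinv (k + 2) x - real k * expinv (k + 1) x) (at x)"
    proof (cases k)
      case 0
      with 1 show ?thesis
        by (auto intro!: derivative_eq_intros simp: expinv_def power2_eq_square field_simps)
    next
      case (Suc m)
      with 1 show ?thesis
        apply (auto intro!: derivative_eq_intros simp: expinv_def power2_eq_square field_simps)
        apply (cases m; simp)
        done
    qed
    then show ?thesis
      by (rule has_field_derivative_transform_within_open[of _ _ _ "{0<..}"])
         (use 1 in \<open>auto simp: expinv_def\<close>)
  next
    case 2
    have "((\<lambda>x. 0) has_real_derivative 0) (at x)" by simp
    then have "(expinv k has_real_derivative 0) (at x)"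
      by (rule has_field_derivative_transform_within_open[of _ _ _ "{..<0}"])
         (use 2 in \<open>auto simp: expinv_def\<close>)
    with 2 show ?thesis by (simp add: expinv_def)
  next
    case 3
    \<comment> \<open>To the right of 0 the difference quotient is \<open>expinv (Suc k)\<close>
      itself, so the limit of the next member of the family is the derivative.\<close>
    have "((\<lambda>y. (expinv k y - expinv k 0) / (y - 0)) \<longlongrightarrow> 0) (at_right 0)"
      by (rule Lim_transform_eventually[OF expinv_tendsto_0[of "Suc k"]])
         (auto simp: expinv_def eventually_at_filter field_simps)
    moreover have "((\<lambda>y. (expinv k y - expinv k 0) / (y - 0)) \<longlongrightarrow> 0) (at_left 0)"
      by (rule tendsto_eventually) (auto simp: expinv_def eventually_at_filter)
    ultimately have "((\<lambda>y. (expinv k y - expinv k 0) / (y - 0)) \<longlongrightarrow> 0) (at 0)"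
      by (simp add: filterlim_split_at)
    then have "(expinv k has_real_derivative 0) (at 0)"
      by (simp add: has_field_derivative_iff)
    with 3 show ?thesis by (simp add: expinv_def)
  qed
qed

text \<open>Differentiation maps the family into its own linear combinations, so the induction on
  the order closes when \<open>k\<close> is arbitrary; the powers of \<open>1/x\<close> are carried
  for this reason.\<close>

lemma smooth1_expinv: "smooth1 (expinv k)"
  unfolding smooth1_def
proof
  fix n show "ndiff n (expinv k)"
  proof (induction n arbitrary: k)
    case (Suc n)
    have "ndiff n (\<lambda>x. expinv (k + 2) x + (- real k) * expinv (k + 1) x)"
      by (intro ndiff_add ndiff_mult ndiff_const Suc)
    then show ?case
      using expinv_has_derivative[of k]
      by (auto intro!: exI[of _ "\<lambda>x. expinv (k + 2) x - real k * expinv (k + 1) x"])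
  qed simp
qed

lemma smooth_step_exists:
  obtains P where "smooth1 P" "\<And>x. x \<le> 0 \<Longrightarrow> P x = 0" "\<And>x. x \<ge> 1 \<Longrightarrow> P x = 1"
    "\<And>x. 0 \<le> P x" "\<And>x. P x \<le> 1" "\<And>x. 0 \<le> deriv P x"
    "\<And>x. x \<notin> {0..1} \<Longrightarrow> deriv P x = 0"
proof -
  \<comment> \<open>Both factors are positive exactly on the open unit interval, so a normalised
    primitive of \<open>r\<close> is the desired step.\<close>
  define r where "r = (\<lambda>x. expinv 0 x * expinv 0 ((-1) * x + 1))"
  have r: "smooth1 r" unfolding r_def by (intro smooth1_intros smooth1_expinv)
  have r0: "r x \<ge> 0" for x by (auto simp: r_def expinv_def)
  have rz: "r x = 0" if "x \<notin> {0<..<1}" for x using that by (auto simp: r_def expinv_def)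
  have rc: "continuous_on S r" for S
    using smooth1_deriv(1)[OF r] by (meson DERIV_isCont continuous_at_imp_continuous_on)
  \<comment> \<open>The lower limit -1 lies strictly left of the support of \<open>r\<close>, so the
    fundamental theorem gives a two-sided derivative at 0; further left \<open>Q\<close> is
    constantly 0.\<close>
  define Q where "Q = (\<lambda>x. integral {-1..x} r)"
  have Qneg: "Q x = 0" if "x \<le> 0" for x
  proof -
    have "integral {-1..x} r = integral {-1..x} (\<lambda>x. 0)"
      by (rule integral_cong) (use that rz in auto)
    then show ?thesis by (simp add: Q_def)
  qed
  have Qd: "(Q has_real_derivative r x) (at x)" for x
  proof (cases "x > -1")
    case True
    have "(Q has_real_derivative r x) (at x within {-1..x + 1})"
      unfolding Q_def by (rule integral_has_real_derivative) (use True rc in auto)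
    then have "(Q has_real_derivative r x) (at x within {-1<..<x + 1})"
      by (rule DERIV_subset) auto
    then show ?thesis using True by (subst (asm) at_within_open) auto
  next
    case False
    have "((\<lambda>x. 0) has_real_derivative 0) (at x)" by simp
    then have "(Q has_real_derivative 0) (at x)"
      by (rule has_field_derivative_transform_within_open[of _ _ _ "{..<0}"])
         (use False Qneg in auto)
    with False rz show ?thesis by simp
  qed
  have Qmono: "Q x \<le> Q y" if "x \<le> y" for x y
    by (rule DERIV_nonneg_imp_nondecreasing[OF that]) (use Qd r0 in blast)
  have Q1: "Q x = Q 1" if "x \<ge> 1" for x
  proof (cases "x = 1")
    case False
    with that have "1 < x" by simp
    then show ?thesis
      by (rule DERIV_isconst_end)
         (use Qd rz in \<open>auto intro!: continuous_at_imp_continuous_on DERIV_isCont, metis greaterThanLessThan_iff less_asym\<close>)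
  qed simp
  have "Q 1 > 0"
  proof -
    have "\<exists>z>0. z < (1::real) \<and> Q 1 - Q 0 = (1 - 0) * r z"
      by (rule MVT2) (use Qd in auto)
    then show ?thesis using Qneg[of 0] by (auto simp: r_def expinv_def)
  qed
  define P where "P = (\<lambda>x. (1 / Q 1) * Q x)"
  have P: "smooth1 P" unfolding P_def
    by (intro smooth1_intros smooth1_antideriv[OF r Qd])
  have Pd: "(P has_real_derivative (1 / Q 1) * r x) (at x)" for x
    unfolding P_def by (rule DERIV_cmult[OF Qd])
  have dP: "deriv P x = (1 / Q 1) * r x" for x by (rule DERIV_imp_deriv[OF Pd])
  show thesis
  proof (rule that[of P])
    show "P x \<le> 1" for x
      using \<open>Q 1 > 0\<close> Q1[of x] Qmono[of x 1] by (cases "x \<le> 1") (auto simp: P_def)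
    show "0 \<le> P x" for x
      using \<open>Q 1 > 0\<close> Qneg[of x] Qmono[of 0 x] Qneg[of 0] by (cases "x \<le> 0") (auto simp: P_def)
    show "P x = 1" if "x \<ge> 1" for x
      using \<open>Q 1 > 0\<close> Q1[OF that] by (simp add: P_def)
  qed (use P Qneg \<open>Q 1 > 0\<close> r0 rz dP in \<open>auto simp: P_def\<close>)
qed

section \<open>Tensor products as test functions\<close>

lemma pd_tensor:
  fixes a b :: "real \<Rightarrow> real"
  assumes "smooth1 a" "smooth1 b"
  shows "pd i (\<lambda>y. a (fst y) * b (snd y)) =
    (if i = 0 then (\<lambda>y. deriv a (fst y) * b (snd y)) else (\<lambda>y. a (fst y) * deriv b (snd y)))"
proof
  fix x :: "real \<times> real"
  have 1: "((\<lambda>s. a (fst x + s)) has_real_derivative deriv a (fst x)) (at 0)"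
    using smooth1_deriv(1)[OF assms(1), of "fst x"] DERIV_shift[of a "deriv a (fst x)" 0 "fst x"]
    by (simp add: add.commute)
  have 2: "((\<lambda>s. b (snd x + s)) has_real_derivative deriv b (snd x)) (at 0)"
    using smooth1_deriv(1)[OF assms(2), of "snd x"] DERIV_shift[of b "deriv b (snd x)" 0 "snd x"]
    by (simp add: add.commute)
  show "pd i (\<lambda>y. a (fst y) * b (snd y)) x =
    (if i = 0 then (\<lambda>y. deriv a (fst y) * b (snd y)) else (\<lambda>y. a (fst y) * deriv b (snd y))) x"
    unfolding pd_def
    by (rule DERIV_imp_deriv)
       (use 1 2 in \<open>auto simp: axis2_def intro!: derivative_eq_intros\<close>)
qed

text \<open>Iterated partial derivatives of a tensor product are again tensor products, which
  reduces smoothness in the plane to smoothness of the two factors.\<close>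

lemma test_fun_tensor:
  fixes a b :: "real \<Rightarrow> real"
  assumes "smooth1 a" "smooth1 b"
    and "\<And>s. s \<notin> {l..u} \<Longrightarrow> a s = 0" "\<And>s. s \<notin> {l'..u'} \<Longrightarrow> b s = 0"
  shows "test_fun (\<lambda>y. a (fst y) * b (snd y))"
proof -
  have *: "\<exists>a' b'. smooth1 a' \<and> smooth1 b' \<and>
      pd_list is (\<lambda>y. a (fst y) * b (snd y)) = (\<lambda>y. a' (fst y) * b' (snd y))" for "is"
  proof (induction "is")
    case (Cons i "is")
    then obtain a' b' where ab: "smooth1 a'" "smooth1 b'"
      "pd_list is (\<lambda>y. a (fst y) * b (snd y)) = (\<lambda>y. a' (fst y) * b' (snd y))" by blast
    then show ?case
      using smooth1_deriv(2)[OF ab(1)] smooth1_deriv(2)[OF ab(2)]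
      by (cases "i = 0") (auto simp: pd_tensor)
  qed (use assms in auto)
  have d: "(\<lambda>y. a' (fst y) * b' (snd y)) differentiable (at x)"
    if "smooth1 a'" "smooth1 b'" for a' b' and x :: "real \<times> real"
  proof (rule differentiable_mult)
    have "a' differentiable (at (fst x))" "b' differentiable (at (snd x))"
      using smooth1_deriv(1) that real_differentiable_def by blast+
    then show "(\<lambda>y. a' (fst y)) differentiable (at x)" "(\<lambda>y. b' (snd y)) differentiable (at x)"
      using differentiable_chain_at[of fst x a'] differentiable_chain_at[of snd x b']
        bounded_linear_imp_differentiable[OF bounded_linear_fst]
        bounded_linear_imp_differentiable[OF bounded_linear_snd]
      by (auto simp: o_def)
  qed
  have "{y. a (fst y) * b (snd y) \<noteq> 0} \<subseteq> cbox (l, l') (u, u')"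
    using assms(3,4) by (fastforce simp: cbox_Pair_eq)
  then have "bounded {y. a (fst y) * b (snd y) \<noteq> 0}"
    using bounded_cbox bounded_subset by blast
  with * d show ?thesis unfolding test_fun_def smooth2_def by metis
qed

section \<open>Weak derivatives and a local Sobolev inequality\<close>

lemma smooth1_continuous: "smooth1 f \<Longrightarrow> continuous_on S f"
  by (meson DERIV_isCont continuous_at_imp_continuous_on smooth1_deriv(1))

section \<open>Plateau functions and almost-everywhere uniqueness of weak derivatives\<close>

lemma plateau_sequence_exists:
  fixes a b :: real
  assumes "a \<le> b"
  obtains \<phi> :: "nat \<Rightarrow> real \<Rightarrow> real" where "\<And>n. smooth1 (\<phi> n)" "\<And>n s. \<bar>\<phi> n s\<bar> \<le> 1"
    "\<And>n s. s \<notin> {a - 1..b + 1} \<Longrightarrow> \<phi> n s = 0" "\<And>n s. s \<in> {a..b} \<Longrightarrow> \<phi> n s = 1"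
    "\<And>s. (\<lambda>n. \<phi> n s) \<longlonglongrightarrow> indicator {a..b} s"
proof -
  obtain P where P: "smooth1 P" "\<And>x. x \<le> 0 \<Longrightarrow> P x = 0" "\<And>x. x \<ge> 1 \<Longrightarrow> P x = 1"
    "\<And>x. 0 \<le> P x" "\<And>x. P x \<le> 1"
    by (rule smooth_step_exists) blast
  \<comment> \<open>The rise ends at \<open>a\<close> and the fall starts at \<open>b\<close>, so
    the value on \<open>{a..b}\<close> is exactly 1. The layers outside have width
    \<open>1 / Suc n \<le> 1\<close>, which keeps all supports in one interval, as dominated
    convergence will want.\<close>
  define \<phi> where "\<phi> = (\<lambda>n s. P (real (Suc n) * s + (1 - real (Suc n) * a)) -
    P (real (Suc n) * s + (- (real (Suc n) * b))))"
  have eq: "\<phi> n s = P (real (Suc n) * (s - a) + 1) - P (real (Suc n) * (s - b))" for n s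
    by (simp add: \<phi>_def algebra_simps)
  have ge: "real (Suc n) * (s - b) \<ge> 1" if "s - b \<ge> 1 / real (Suc n)" for n s
    using that by (simp add: field_simps)
  have le: "real (Suc n) * (s - a) + 1 \<le> 0" if "a - s \<ge> 1 / real (Suc n)" for n s
    using that by (simp add: field_simps)
  have inside: "\<phi> n s = 1" if "s \<in> {a..b}" for n s
    using that by (simp add: eq P mult_nonneg_nonpos)
  have left: "\<phi> n s = 0" if "a - s \<ge> 1 / real (Suc n)" for n s
  proof -
    have "0 \<le> 1 / real (Suc n)" by simp
    then have "s \<le> b" using that assms by linarith
    then show ?thesis using le[OF that] by (simp add: eq P mult_nonneg_nonpos)
  qed
  have right: "\<phi> n s = 0" if "s - b \<ge> 1 / real (Suc n)" for n s
  proof -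
    have "0 \<le> 1 / real (Suc n)" by simp
    then have "s \<ge> a" using that assms by linarith
    then show ?thesis using ge[OF that] by (simp add: eq P)
  qed
  show thesis
  proof (rule that)
    show "smooth1 (\<phi> n)" for n
      unfolding \<phi>_def by (intro smooth1_diff smooth1_intros(4) P)
    show "\<bar>\<phi> n s\<bar> \<le> 1" for n s
      using P(4,5)[of "real (Suc n) * (s - a) + 1"] P(4,5)[of "real (Suc n) * (s - b)"]
      by (simp add: eq abs_le_iff)
    show "\<phi> n s = 0" if "s \<notin> {a - 1..b + 1}" for n s
    proof -
      have "1 / real (Suc n) \<le> 1" by simp
      with that show ?thesis using left[of n s] right[of n s] by fastforce
    qed
    show "(\<lambda>n. \<phi> n s) \<longlonglongrightarrow> indicator {a..b} s" for s
    proof (cases "s \<in> {a..b}")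
      case True
      then show ?thesis using inside by simp
    next
      case False
      then have "0 < max (a - s) (s - b)" by auto
      then obtain N where N: "1 / real (Suc N) < max (a - s) (s - b)"
        using nat_approx_posE by blast
      have "\<phi> n s = 0" if "n \<ge> N" for n
      proof -
        have "1 / real (Suc n) \<le> 1 / real (Suc N)" using that by (simp add: frac_le)
        with N have "a - s \<ge> 1 / real (Suc n) \<or> s - b \<ge> 1 / real (Suc n)" by linarith
        then show ?thesis using left right by blast
      qed
      then have "(\<lambda>n. \<phi> n s) \<longlonglongrightarrow> 0"
        by (intro tendsto_eventually) (auto simp: eventually_sequentially)
      with False show ?thesis by simp
    qed
  qed (use inside in auto)
qed

text \<open>Plateau functions make every box integral of \<open>h\<close> vanish, and Lebesgue
  differentiation along shrinking boxes then gives \<open>h x = 0\<close> off a null set.\<close>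

lemma AE_eq_0_if_orthogonal_to_test_fun:
  fixes h :: "real \<times> real \<Rightarrow> real"
  assumes [measurable]: "h \<in> borel_measurable borel"
    and int: "\<And>\<phi>. test_fun \<phi> \<Longrightarrow> integrable lborel (\<lambda>x. h x * \<phi> x)"
    and zero: "\<And>\<phi>. test_fun \<phi> \<Longrightarrow> (\<integral>x. h x * \<phi> x \<partial>lborel) = 0"
  shows "AE x in lborel. h x = 0"
proof -
  \<comment> \<open>Integrability over a box is read off from a test function that equals 1
    there.\<close>
  have box_int: "set_integrable lborel (cbox (a, c) (b, d)) h"
    if le: "a \<le> b" "c \<le> d" for a b c d
  proof -
    obtain \<phi> where \<phi>: "\<And>n. smooth1 (\<phi> n)"
      "\<And>n s. s \<notin> {a - 1..b + 1} \<Longrightarrow> \<phi> n s = 0" "\<And>n s. s \<in> {a..b} \<Longrightarrow> \<phi> (n::nat) s = 1"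
      using plateau_sequence_exists[OF le(1)] by metis
    obtain \<psi> where \<psi>: "\<And>n. smooth1 (\<psi> n)"
      "\<And>n s. s \<notin> {c - 1..d + 1} \<Longrightarrow> \<psi> n s = 0" "\<And>n s. s \<in> {c..d} \<Longrightarrow> \<psi> (n::nat) s = 1"
      using plateau_sequence_exists[OF le(2)] by metis
    have "test_fun (\<lambda>y. \<phi> 0 (fst y) * \<psi> 0 (snd y))"
      by (rule test_fun_tensor[of _ _ "a - 1" "b + 1" "c - 1" "d + 1"]) (use \<phi> \<psi> in auto)
    from int[OF this] show ?thesis
      unfolding set_integrable_def
    proof (rule Bochner_Integration.integrable_bound)
      show "AE y in lborel. norm (indicat_real (cbox (a, c) (b, d)) y *\<^sub>R h y)
          \<le> norm (h y * (\<phi> 0 (fst y) * \<psi> 0 (snd y)))"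
        by (auto simp: cbox_Pair_eq \<phi> \<psi> split: split_indicator)
    qed measurable
  qed
  have box_zero: "(LINT y:cbox (a, c) (b, d)|lborel. h y) = 0"
    if le: "a \<le> b" "c \<le> d" for a b c d
  proof -
    obtain \<phi> where \<phi>: "\<And>n. smooth1 (\<phi> n)" "\<And>n s. \<bar>\<phi> n s\<bar> \<le> 1"
      "\<And>n s. s \<notin> {a - 1..b + 1} \<Longrightarrow> \<phi> n s = 0" "\<And>s. (\<lambda>n. \<phi> n s) \<longlonglongrightarrow> indicator {a..b} s"
      using plateau_sequence_exists[OF le(1)] by metis
    obtain \<psi> where \<psi>: "\<And>n. smooth1 (\<psi> n)" "\<And>n s. \<bar>\<psi> n s\<bar> \<le> 1"
      "\<And>n s. s \<notin> {c - 1..d + 1} \<Longrightarrow> \<psi> n s = 0" "\<And>s. (\<lambda>n. \<psi> n s) \<longlonglongrightarrow> indicator {c..d} s"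
      using plateau_sequence_exists[OF le(2)] by metis
    have tf: "test_fun (\<lambda>y. \<phi> n (fst y) * \<psi> n (snd y))" for n
      by (rule test_fun_tensor[of _ _ "a - 1" "b + 1" "c - 1" "d + 1"]) (use \<phi> \<psi> in auto)
    have "(\<lambda>n. \<integral>y. h y * (\<phi> n (fst y) * \<psi> n (snd y)) \<partial>lborel)
        \<longlonglongrightarrow> (\<integral>y. indicator (cbox (a, c) (b, d)) y *\<^sub>R h y \<partial>lborel)"
    proof (rule integral_dominated_convergence
        [where w = "\<lambda>y. indicator (cbox (a - 1, c - 1) (b + 1, d + 1)) y *\<^sub>R \<bar>h y\<bar>"])
      show "integrable lborel (\<lambda>y. indicator (cbox (a - 1, c - 1) (b + 1, d + 1)) y *\<^sub>R \<bar>h y\<bar>)"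
        using set_integrable_abs[OF box_int[of "a - 1" "b + 1" "c - 1" "d + 1"]] le
        by (simp add: set_integrable_def)
      show "AE y in lborel. (\<lambda>n. h y * (\<phi> n (fst y) * \<psi> n (snd y)))
          \<longlonglongrightarrow> indicator (cbox (a, c) (b, d)) y *\<^sub>R h y"
      proof (rule AE_I2)
        fix y :: "real \<times> real"
        have "(\<lambda>n. h y * (\<phi> n (fst y) * \<psi> n (snd y)))
            \<longlonglongrightarrow> h y * (indicator {a..b} (fst y) * indicator {c..d} (snd y))"
          by (intro tendsto_intros \<phi> \<psi>)
        also have "h y * (indicator {a..b} (fst y) * indicator {c..d} (snd y)) =
            indicator (cbox (a, c) (b, d)) y *\<^sub>R h y"
          by (cases y) (auto simp: cbox_Pair_eq split: split_indicator)
        finally show "(\<lambda>n. h y * (\<phi> n (fst y) * \<psi> n (snd y)))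
          \<longlonglongrightarrow> indicator (cbox (a, c) (b, d)) y *\<^sub>R h y" .
      qed
      show "AE y in lborel. norm (h y * (\<phi> n (fst y) * \<psi> n (snd y)))
          \<le> indicator (cbox (a - 1, c - 1) (b + 1, d + 1)) y *\<^sub>R \<bar>h y\<bar>" for n
      proof (rule AE_I2)
        fix y :: "real \<times> real"
        have "\<bar>\<phi> n (fst y) * \<psi> n (snd y)\<bar> \<le> 1 * 1"
          unfolding abs_mult by (intro mult_mono \<phi> \<psi>) auto
        then have "\<bar>h y\<bar> * \<bar>\<phi> n (fst y) * \<psi> n (snd y)\<bar> \<le> \<bar>h y\<bar>"
          by (intro mult_left_le) auto
        then show "norm (h y * (\<phi> n (fst y) * \<psi> n (snd y)))
          \<le> indicator (cbox (a - 1, c - 1) (b + 1, d + 1)) y *\<^sub>R \<bar>h y\<bar>"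
          using \<phi>(3)[of "fst y" n] \<psi>(3)[of "snd y" n]
          by (cases y) (auto simp: cbox_Pair_eq abs_mult split: split_indicator)
      qed
      show "(\<lambda>y. h y * (\<phi> n (fst y) * \<psi> n (snd y))) \<in> borel_measurable lborel" for n
        using int[OF tf] by (rule borel_measurable_integrable)
    qed auto
    then have "(\<lambda>n. 0) \<longlonglongrightarrow> (\<integral>y. indicator (cbox (a, c) (b, d)) y *\<^sub>R h y \<partial>lborel)"
      using zero[OF tf] by simp
    then show ?thesis by (simp add: set_lebesgue_integral_def LIMSEQ_const_iff)
  qed
  have HK: "h integrable_on cbox p q \<and> integral (cbox p q) h = 0" for p q
  proof (cases "fst p \<le> fst q \<and> snd p \<le> snd q")
    case True
    then show ?thesis
      using set_borel_integral_eq_integral[OF box_int[of "fst p" "fst q" "snd p" "snd q"]]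
        box_zero[of "fst p" "fst q" "snd p" "snd q"] by simp
  next
    case False
    then have "cbox p q = {}" by (cases p; cases q) (auto simp: cbox_Pair_eq)
    then show ?thesis by (simp add: integrable_on_empty)
  qed
  \<comment> \<open>Lebesgue differentiation along cubes with corner \<open>x\<close>. All their
    integrals are 0, so the tolerance \<open>\<bar>h x\<bar>\<close> is contradictory unless
    \<open>h x = 0\<close>.\<close>
  obtain N where N: "negligible N"
       "\<And>x e. \<lbrakk>x \<notin> N; 0 < e\<rbrakk> \<Longrightarrow> \<exists>d>0. \<forall>k. 0 < k \<and> k < d \<longrightarrow>
            norm (integral (cbox x (x + k *\<^sub>R One)) h /\<^sub>R k ^ DIM(real \<times> real) - h x) < e"
    using integrable_ccontinuous_explicit[of h] HK by metis
  have "h x = 0" if x: "x \<notin> N" for x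
  proof (rule ccontr)
    assume "h x \<noteq> 0"
    then obtain d where d: "d > 0" "\<And>k. 0 < k \<Longrightarrow> k < d \<Longrightarrow>
       norm (integral (cbox x (x + k *\<^sub>R One)) h /\<^sub>R k ^ DIM(real \<times> real) - h x) < \<bar>h x\<bar>"
      using N(2)[OF x, of "\<bar>h x\<bar>"] by auto
    from d(2)[of "d / 2"] d(1) HK show False by simp
  qed
  then have "{x. h x \<noteq> 0} \<subseteq> N" by auto
  then have "negligible {x. h x \<noteq> 0}" using N(1) negligible_subset by blast
  then have "{x. h x \<noteq> 0} \<in> null_sets lborel"
    by (simp add: negligible_iff_null_sets null_sets_completion_iff)
  then show ?thesis by (auto intro: AE_I')
qed

lemma weak_deriv_unique_AE:
  assumes "has_weak_deriv \<alpha> g h1" "has_weak_deriv \<alpha> g h2"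
  shows "AE x in lborel. h1 x = h2 x"
proof -
  have [measurable]: "h1 \<in> borel_measurable borel" "h2 \<in> borel_measurable borel"
    using assms by (auto simp: has_weak_deriv_def)
  have "AE x in lborel. h1 x - h2 x = 0"
  proof (rule AE_eq_0_if_orthogonal_to_test_fun)
    fix \<phi> assume "test_fun \<phi>"
    then have *: "integrable lborel (\<lambda>x. h1 x * \<phi> x)" "integrable lborel (\<lambda>x. h2 x * \<phi> x)"
      "(\<integral>x. h1 x * \<phi> x \<partial>lborel) = (\<integral>x. h2 x * \<phi> x \<partial>lborel)"
      using assms unfolding has_weak_deriv_def by auto
    then show "integrable lborel (\<lambda>x. (h1 x - h2 x) * \<phi> x)"
      "(\<integral>x. (h1 x - h2 x) * \<phi> x \<partial>lborel) = 0"
      by (simp_all add: left_diff_distrib)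
  qed simp
  then show ?thesis by simp
qed

section \<open>A Sobolev inequality on one-sided boxes\<close>

definition side :: "real \<Rightarrow> bool \<Rightarrow> real set" where
  "side x s = (if s then {x..x + 2} else {x - 2..x})"

text \<open>Side length 2 leaves room for a rise next to the corner \<open>x\<close> and a fall of
  unit length; since \<open>2 \<le> pi\<close>, one of the two directions stays inside
  \<open>{0..2*pi}\<close> from any of its points.\<close>

definition quadrant_box :: "real \<times> real \<Rightarrow> bool \<Rightarrow> bool \<Rightarrow> (real \<times> real) set" where
  "quadrant_box x s t = side (fst x) s \<times> side (snd x) t"

text \<open>The mollifier \<open>a' + b\<close> concentrates as \<open>e\<close> decreases to 0 while \<open>a\<close> and \<open>b\<close> stay bounded. It is
  one-sided so that its support can be kept inside the fundamental square of the torus; this avoids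
  having to show that weak derivatives of periodic functions are periodic.\<close>
lemma one_sided_mollifier:
  obtains M where "M > 0"
    "\<And>x s e. 0 < e \<Longrightarrow> e \<le> 1 \<Longrightarrow> \<exists>a b. smooth1 a \<and> smooth1 b \<and>
      (\<forall>y. \<bar>a y\<bar> \<le> M \<and> \<bar>b y\<bar> \<le> M) \<and> (\<forall>y. y \<notin> side x s \<longrightarrow> a y = 0 \<and> b y = 0) \<and>
      (\<forall>y. 0 \<le> deriv a y + b y) \<and> (\<forall>y. \<bar>y - x\<bar> > e \<longrightarrow> deriv a y + b y = 0) \<and>
      has_bochner_integral lborel (\<lambda>y. deriv a y + b y) 1"
proof -
  obtain P where P: "smooth1 P" "\<And>x. x \<le> 0 \<Longrightarrow> P x = 0" "\<And>x. x \<ge> 1 \<Longrightarrow> P x = 1"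
    "\<And>x. 0 \<le> P x" "\<And>x. P x \<le> 1" "\<And>x. 0 \<le> deriv P x" "\<And>x. x \<notin> {0..1} \<Longrightarrow> deriv P x = 0"
    by (rule smooth_step_exists) blast
  define \<rho> where "\<rho> = deriv P"
  have \<rho>: "smooth1 \<rho>" and Pd: "(P has_real_derivative \<rho> y) (at y)" for y
    unfolding \<rho>_def using smooth1_deriv[OF P(1)] by auto
  have "compact (\<rho> ` {0..1})" by (intro compact_continuous_image smooth1_continuous \<rho>) auto
  then have "bounded (\<rho> ` {0..1})" by (rule compact_imp_bounded)
  then obtain M0 where "\<forall>z\<in>\<rho> ` {0..1}. \<bar>z\<bar> \<le> M0"
    unfolding bounded_real by blast
  then have M0: "\<And>y. y \<in> {0..1} \<Longrightarrow> \<bar>\<rho> y\<bar> \<le> M0" by blast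
  define M where "M = max 1 M0"
  have M: "\<bar>\<rho> y\<bar> \<le> M" for y
    using M0[of y] P(7)[of y] by (cases "y \<in> {0..1}") (auto simp: M_def \<rho>_def)
  show thesis
  proof (rule that[of M])
    show "M > 0" by (simp add: M_def)
    fix x e :: real and s :: bool
    assume e: "0 < e" "e \<le> 1"
    define \<sigma> where "\<sigma> = (if s then 1 else -1 :: real)"
    have \<sigma>: "\<sigma> * \<sigma> = 1" "\<bar>\<sigma>\<bar> = 1" by (auto simp: \<sigma>_def)
    \<comment> \<open>Up to the sign \<sigma>, the first \<open>P\<close> rises from 0 to 1 within
      distance \<open>e\<close> of \<open>x\<close> and the second brings \<open>a\<close> back to 0
      between distances 1 and 2. That fall contributes \<open>- b\<close> to \<open>deriv a\<close>,
      so \<open>deriv a + b\<close> is the narrow bump alone, while the bounds on \<open>a\<close>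
      and \<open>b\<close> do not depend on \<open>e\<close>.\<close>
    define a where "a = (\<lambda>y. \<sigma> * (P ((\<sigma> / e) * y + (- \<sigma> * x / e)) - P (\<sigma> * y + (- \<sigma> * x - 1))))"
    define b where "b = (\<lambda>y. \<rho> (\<sigma> * y + (- \<sigma> * x - 1)))"
    have arg: "(\<sigma> / e) * y + (- \<sigma> * x / e) = \<sigma> * (y - x) / e"
      "\<sigma> * y + (- \<sigma> * x - 1) = \<sigma> * (y - x) - 1" for y
      using e by (auto simp: field_simps)
    have chain: "((\<lambda>y. P (c * y + d)) has_real_derivative \<rho> (c * y + d) * c) (at y)" for c d y
      by (rule DERIV_chain'[where f = "\<lambda>x. c * x + d"]) (auto intro!: derivative_eq_intros Pd)
    have "(a has_real_derivative \<sigma> * (\<rho> ((\<sigma> / e) * y + (- \<sigma> * x / e)) * (\<sigma> / e)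
        - \<rho> (\<sigma> * y + (- \<sigma> * x - 1)) * \<sigma>)) (at y)" for y
      unfolding a_def by (intro DERIV_cmult DERIV_diff chain)
    then have "deriv a y = \<sigma> * (\<rho> (\<sigma> * (y - x) / e) * (\<sigma> / e) - b y * \<sigma>)" for y
      unfolding b_def arg[symmetric] by (rule DERIV_imp_deriv)
    then have "deriv a y = \<sigma> * \<sigma> * (\<rho> (\<sigma> * (y - x) / e) / e - b y)" for y
      by (simp add: algebra_simps)
    then have r: "deriv a y + b y = \<rho> (\<sigma> * (y - x) / e) / e" for y
      by (simp add: \<sigma>)
    have rz: "deriv a y + b y = 0" if "\<bar>y - x\<bar> > e" for y
    proof -
      define u where "u = \<sigma> * (y - x) / e"
      have "\<bar>u\<bar> > 1" using that e \<sigma> by (simp add: u_def abs_mult)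
      then have "u \<notin> {0..1}" by auto
      then show ?thesis unfolding r \<rho>_def u_def[symmetric] using P(7)[of u] by simp
    qed
    \<comment> \<open>The boundary term is \<open>\<sigma> * (P \<sigma> - P (-\<sigma>))\<close>,
      which is 1 for either sign because \<open>P 1 = 1\<close> and
      \<open>P (-1) = 0\<close>.\<close>
    have "has_bochner_integral lborel (\<lambda>y. (deriv a y + b y) * indicator {x - e..x + e} y)
       (\<sigma> * P (\<sigma> / e * (x + e) + (- \<sigma> * x / e)) - \<sigma> * P (\<sigma> / e * (x - e) + (- \<sigma> * x / e)))"
    proof (rule has_bochner_integral_FTC_Icc_nonneg)
      show "(\<lambda>y. deriv a y + b y) \<in> borel_measurable borel"
        unfolding r by (intro borel_measurable_continuous_onI continuous_intros
          continuous_on_compose2[OF smooth1_continuous[OF \<rho>, of UNIV]]) (use e in auto)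
      fix y
      have "((\<lambda>y. \<sigma> * P ((\<sigma> / e) * y + (- \<sigma> * x / e))) has_real_derivative
          \<sigma> * (\<rho> ((\<sigma> / e) * y + (- \<sigma> * x / e)) * (\<sigma> / e))) (at y)"
        by (intro DERIV_cmult chain)
      moreover have "\<sigma> * (\<rho> ((\<sigma> / e) * y + (- \<sigma> * x / e)) * (\<sigma> / e)) = deriv a y + b y"
        unfolding arg r by (simp add: \<sigma>_def)
      ultimately show "((\<lambda>y. \<sigma> * P ((\<sigma> / e) * y + (- \<sigma> * x / e))) has_real_derivative
          deriv a y + b y) (at y)" by simp
      show "0 \<le> deriv a y + b y" unfolding r \<rho>_def using P(6) e by simp
    qed (use e in auto)
    also have "(\<lambda>y. (deriv a y + b y) * indicator {x - e..x + e} y) = (\<lambda>y. deriv a y + b y)"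
      using rz by (auto simp: fun_eq_iff abs_if split: split_indicator)
    also have "\<sigma> * P (\<sigma> / e * (x + e) + (- \<sigma> * x / e)) - \<sigma> * P (\<sigma> / e * (x - e) + (- \<sigma> * x / e)) = 1"
      unfolding arg using e P(2)[of "-1"] P(3)[of 1] by (simp add: \<sigma>_def)
    finally have I: "has_bochner_integral lborel (\<lambda>y. deriv a y + b y) 1" .
    have "\<bar>a y\<bar> \<le> M" for y
      using P(4,5)[of "\<sigma> * (y - x) / e"] P(4,5)[of "\<sigma> * (y - x) - 1"] \<sigma>
      unfolding a_def arg abs_mult by (auto simp: M_def abs_le_iff)
    moreover have "a y = 0 \<and> b y = 0" if "y \<notin> side x s" for y
    proof -
      define u where "u = \<sigma> * (y - x)"
      have "u < 0 \<or> u > 2" using that by (auto simp: side_def \<sigma>_def u_def split: if_splits)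
      moreover have "u / e \<ge> 1" if "u > 2" using that e by (simp add: field_simps)
      moreover have "u / e \<le> 0" if "u < 0" using that e by (simp add: divide_nonpos_pos)
      ultimately show ?thesis
        unfolding a_def b_def arg u_def[symmetric] \<rho>_def
        using P(2)[of "u / e"] P(2)[of "u - 1"] P(3)[of "u / e"] P(3)[of "u - 1"] P(7)[of "u - 1"]
        by auto
    qed
    moreover have "0 \<le> deriv a y + b y" for y unfolding r \<rho>_def using P(6) e by simp
    moreover have "smooth1 a" "smooth1 b"
      unfolding a_def b_def by (intro smooth1_intros smooth1_diff P \<rho>)+
    moreover have "\<bar>b y\<bar> \<le> M" for y unfolding b_def by (rule M)
    ultimately show "\<exists>a b. smooth1 a \<and> smooth1 b \<and>
      (\<forall>y. \<bar>a y\<bar> \<le> M \<and> \<bar>b y\<bar> \<le> M) \<and> (\<forall>y. y \<notin> side x s \<longrightarrow> a y = 0 \<and> b y = 0) \<and>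
      (\<forall>y. 0 \<le> deriv a y + b y) \<and> (\<forall>y. \<bar>y - x\<bar> > e \<longrightarrow> deriv a y + b y = 0) \<and>
      has_bochner_integral lborel (\<lambda>y. deriv a y + b y) 1"
      using I rz by blast
  qed
qed

lemma has_bochner_integral_tensor:
  fixes u v :: "real \<Rightarrow> real"
  assumes "has_bochner_integral lborel u I" "has_bochner_integral lborel v J"
  shows "has_bochner_integral lborel (\<lambda>y. u (fst y) * v (snd y)) (I * J)"
proof -
  have u: "integrable lborel u" "integral\<^sup>L lborel u = I" and v: "integrable lborel v" "integral\<^sup>L lborel v = J"
    using assms by (auto simp: has_bochner_integral_iff)
  have [measurable]: "u \<in> borel_measurable borel" "v \<in> borel_measurable borel"
    using u v by (auto dest: borel_measurable_integrable)
  have int: "integrable (lborel \<Otimes>\<^sub>M lborel) (\<lambda>y. u (fst y) * v (snd y))"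
    by (rule lborel_pair.Fubini_integrable) (use u v in \<open>auto simp: abs_mult\<close>)
  from lborel_pair.integral_fst'[OF int] u v
  have "integral\<^sup>L (lborel \<Otimes>\<^sub>M lborel) (\<lambda>y. u (fst y) * v (snd y)) = I * J" by simp
  with int show ?thesis by (simp add: has_bochner_integral_iff lborel_prod)
qed

text \<open>A product of two mollifiers \<open>deriv a + b\<close>, one in each variable, expands
  into four terms, and these are the derivatives that occur. Their order is at most 2, which is
  where \<open>k \<ge> 2\<close> comes from.\<close>

abbreviation corner_multis :: "(nat \<times> nat) set" where
  "corner_multis \<equiv> {0, 1} \<times> {0, 1}"

lemma quadrant_box_sets [measurable]: "quadrant_box x s t \<in> sets borel"
  by (auto simp: quadrant_box_def side_def borel_Times)

text \<open>Testing with the product mollifier and moving its derivatives onto \<open>g\<close>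
  leaves only bounded weights in front of the weak derivatives. The resulting bound is uniform in
  the width, and by continuity of \<open>g\<close> the width may shrink. An upper bound is enough,
  as it applies to \<open>- g\<close> too.\<close>

lemma sobolev_quadrant_upper:
  obtains C where "C > 0"
    "\<And>g h x s t. continuous_on UNIV g \<Longrightarrow>
      (\<And>\<alpha>. \<alpha> \<in> corner_multis \<Longrightarrow> has_weak_deriv \<alpha> g (h \<alpha>)) \<Longrightarrow>
      (\<And>\<alpha>. \<alpha> \<in> corner_multis \<Longrightarrow> set_integrable lborel (quadrant_box x s t) (h \<alpha>)) \<Longrightarrow>
      g x \<le> C * (\<Sum>\<alpha>\<in>corner_multis. LINT y:quadrant_box x s t|lborel. \<bar>h \<alpha> y\<bar>)"
proof -
  obtain M where M: "M > 0"
    "\<And>x s e. 0 < e \<Longrightarrow> e \<le> 1 \<Longrightarrow> \<exists>a b. smooth1 a \<and> smooth1 b \<and>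
      (\<forall>y. \<bar>a y\<bar> \<le> M \<and> \<bar>b y\<bar> \<le> M) \<and> (\<forall>y. y \<notin> side x s \<longrightarrow> a y = 0 \<and> b y = 0) \<and>
      (\<forall>y. 0 \<le> deriv a y + b y) \<and> (\<forall>y. \<bar>y - x\<bar> > e \<longrightarrow> deriv a y + b y = 0) \<and>
      has_bochner_integral lborel (\<lambda>y. deriv a y + b y) 1"
    by (rule one_sided_mollifier) blast
  show thesis
  proof (rule that[of "M * M"])
    show "M * M > 0" using M(1) by simp
    fix g :: "real \<times> real \<Rightarrow> real" and h x s t
    assume cont: "continuous_on UNIV g"
      and wd: "\<And>\<alpha>. \<alpha> \<in> corner_multis \<Longrightarrow> has_weak_deriv \<alpha> g (h \<alpha>)"
      and si: "\<And>\<alpha>. \<alpha> \<in> corner_multis \<Longrightarrow> set_integrable lborel (quadrant_box x s t) (h \<alpha>)"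
    define N where "N = (\<lambda>\<alpha>. LINT y:quadrant_box x s t|lborel. \<bar>h \<alpha> y\<bar>)"
    have bound: "\<bar>\<integral>y. h \<alpha> y * (u (fst y) * v (snd y)) \<partial>lborel\<bar> \<le> M * M * N \<alpha>"
      if \<alpha>: "\<alpha> \<in> corner_multis"
        and u: "\<And>y. \<bar>u y\<bar> \<le> M" "\<And>y. y \<notin> side (fst x) s \<Longrightarrow> u y = 0"
        and v: "\<And>y. \<bar>v y\<bar> \<le> M" "\<And>y. y \<notin> side (snd x) t \<Longrightarrow> v y = 0"
      for \<alpha> and u v :: "real \<Rightarrow> real"
    proof -
      have "\<bar>\<integral>y. h \<alpha> y * (u (fst y) * v (snd y)) \<partial>lborel\<bar> \<le> (\<integral>y. \<bar>h \<alpha> y * (u (fst y) * v (snd y))\<bar> \<partial>lborel)"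
        by (rule integral_abs_bound)
      also have "\<dots> \<le> (\<integral>y. M * M * (indicator (quadrant_box x s t) y *\<^sub>R \<bar>h \<alpha> y\<bar>) \<partial>lborel)"
      proof (rule integral_mono')
        show "integrable lborel (\<lambda>y. M * M * (indicator (quadrant_box x s t) y *\<^sub>R \<bar>h \<alpha> y\<bar>))"
          using set_integrable_abs[OF si[OF \<alpha>]] by (simp add: set_integrable_def)
        fix y :: "real \<times> real"
        have "\<bar>u (fst y) * v (snd y)\<bar> \<le> M * M"
          unfolding abs_mult by (intro mult_mono u v) (use M in auto)
        then have "\<bar>h \<alpha> y\<bar> * \<bar>u (fst y) * v (snd y)\<bar> \<le> \<bar>h \<alpha> y\<bar> * (M * M)"
          by (rule mult_left_mono) simp
        then show "\<bar>h \<alpha> y * (u (fst y) * v (snd y))\<bar> \<le> M * M * (indicator (quadrant_box x s t) y *\<^sub>R \<bar>h \<alpha> y\<bar>)"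
          using u(2)[of "fst y"] v(2)[of "snd y"]
          by (cases y) (auto simp: quadrant_box_def abs_mult mult_ac split: split_indicator)
        show "0 \<le> M * M * (indicator (quadrant_box x s t) y *\<^sub>R \<bar>h \<alpha> y\<bar>)" by simp
      qed
      also have "\<dots> = M * M * N \<alpha>"
        by (simp add: N_def set_lebesgue_integral_def)
      finally show ?thesis .
    qed
    have "g x \<le> M * M * (\<Sum>\<alpha>\<in>corner_multis. N \<alpha>) + \<eta>" if "\<eta> > 0" for \<eta>
    proof -
      obtain \<delta> where \<delta>: "\<delta> > 0" "\<And>y. dist y x < \<delta> \<Longrightarrow> \<bar>g y - g x\<bar> < \<eta>"
        using cont \<open>\<eta> > 0\<close> unfolding continuous_on_iff dist_real_def by (metis UNIV_I)
      \<comment> \<open>The mollifier needs width at most 1; \<open>\<delta> / 3\<close> keeps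
        \<open>2 * e\<close>, which bounds the sum of the two coordinate distances, below
        \<delta>.\<close>
      define e where "e = min 1 (\<delta> / 3)"
      have e: "0 < e" "e \<le> 1" "2 * e < \<delta>" using \<delta>(1) by (auto simp: e_def min_def)
      obtain a1 b1 where 1: "smooth1 a1" "smooth1 b1" "\<And>y. \<bar>a1 y\<bar> \<le> M" "\<And>y. \<bar>b1 y\<bar> \<le> M"
        "\<And>y. y \<notin> side (fst x) s \<Longrightarrow> a1 y = 0" "\<And>y. y \<notin> side (fst x) s \<Longrightarrow> b1 y = 0"
        "\<And>y. 0 \<le> deriv a1 y + b1 y" "\<And>y. \<bar>y - fst x\<bar> > e \<Longrightarrow> deriv a1 y + b1 y = 0"
        "has_bochner_integral lborel (\<lambda>y. deriv a1 y + b1 y) 1"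
        using M(2)[OF e(1,2), of "fst x" s] by (elim exE conjE) (rule that; simp)
      obtain a2 b2 where 2: "smooth1 a2" "smooth1 b2" "\<And>y. \<bar>a2 y\<bar> \<le> M" "\<And>y. \<bar>b2 y\<bar> \<le> M"
        "\<And>y. y \<notin> side (snd x) t \<Longrightarrow> a2 y = 0" "\<And>y. y \<notin> side (snd x) t \<Longrightarrow> b2 y = 0"
        "\<And>y. 0 \<le> deriv a2 y + b2 y" "\<And>y. \<bar>y - snd x\<bar> > e \<Longrightarrow> deriv a2 y + b2 y = 0"
        "has_bochner_integral lborel (\<lambda>y. deriv a2 y + b2 y) 1"
        using M(2)[OF e(1,2), of "snd x" t] by (elim exE conjE) (rule that; simp)
      define r where "r = (\<lambda>y. (deriv a1 (fst y) + b1 (fst y)) * (deriv a2 (snd y) + b2 (snd y)))"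
      have tf: "test_fun (\<lambda>y. u (fst y) * v (snd y))"
        if "smooth1 u" "smooth1 v" "\<And>y. y \<notin> side (fst x) s \<Longrightarrow> u y = 0" "\<And>y. y \<notin> side (snd x) t \<Longrightarrow> v y = 0"
        for u v
        by (rule test_fun_tensor[of _ _ "fst x - 2" "fst x + 2" "snd x - 2" "snd x + 2"])
           (use that in \<open>auto simp: side_def\<close>)
      have D11: "Dmulti (1, 1) (\<lambda>y. a1 (fst y) * a2 (snd y)) = (\<lambda>y. deriv a1 (fst y) * deriv a2 (snd y))"
        using 1 2 by (simp add: Dmulti_def pd_tensor smooth1_deriv(2))
      have D10: "Dmulti (1, 0) (\<lambda>y. a1 (fst y) * b2 (snd y)) = (\<lambda>y. deriv a1 (fst y) * b2 (snd y))"
        using 1 2 by (simp add: Dmulti_def pd_tensor)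
      have D01: "Dmulti (0, 1) (\<lambda>y. b1 (fst y) * a2 (snd y)) = (\<lambda>y. b1 (fst y) * deriv a2 (snd y))"
        using 1 2 by (simp add: Dmulti_def pd_tensor)
      have D00: "Dmulti (0, 0) (\<lambda>y. b1 (fst y) * b2 (snd y)) = (\<lambda>y. b1 (fst y) * b2 (snd y))"
        by (simp add: Dmulti_def)
      have *: "integrable lborel (\<lambda>y. g y * Dmulti \<alpha> \<phi> y) \<and>
          (\<integral>y. g y * Dmulti \<alpha> \<phi> y \<partial>lborel) = (-1) ^ (fst \<alpha> + snd \<alpha>) * (\<integral>y. h \<alpha> y * \<phi> y \<partial>lborel)"
        if "test_fun \<phi>" "\<alpha> \<in> corner_multis" for \<phi> \<alpha>
        using wd[OF that(2)] that(1) unfolding has_weak_deriv_def by blast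
      note I11 = *[OF tf[of a1 a2], of "(1,1)", unfolded D11]
      note I10 = *[OF tf[of a1 b2], of "(1,0)", unfolded D10]
      note I01 = *[OF tf[of b1 a2], of "(0,1)", unfolded D01]
      note I00 = *[OF tf[of b1 b2], of "(0,0)", unfolded D00]
      \<comment> \<open>The sign from integration by parts disappears in the absolute value of
        \<open>bound\<close>.\<close>
      have B11: "integrable lborel (\<lambda>y. g y * (deriv a1 (fst y) * deriv a2 (snd y)))"
        "(\<integral>y. g y * (deriv a1 (fst y) * deriv a2 (snd y)) \<partial>lborel) \<le> M * M * N (1,1)"
        using I11 bound[of "(1,1)" a1 a2] 1 2 by auto
      have B10: "integrable lborel (\<lambda>y. g y * (deriv a1 (fst y) * b2 (snd y)))"
        "(\<integral>y. g y * (deriv a1 (fst y) * b2 (snd y)) \<partial>lborel) \<le> M * M * N (1,0)"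
        using I10 bound[of "(1,0)" a1 b2] 1 2 by auto
      have B01: "integrable lborel (\<lambda>y. g y * (b1 (fst y) * deriv a2 (snd y)))"
        "(\<integral>y. g y * (b1 (fst y) * deriv a2 (snd y)) \<partial>lborel) \<le> M * M * N (0,1)"
        using I01 bound[of "(0,1)" b1 a2] 1 2 by auto
      have B00: "integrable lborel (\<lambda>y. g y * (b1 (fst y) * b2 (snd y)))"
        "(\<integral>y. g y * (b1 (fst y) * b2 (snd y)) \<partial>lborel) \<le> M * M * N (0,0)"
        using I00 bound[of "(0,0)" b1 b2] 1 2 by auto
      have gr: "g y * r y = g y * (deriv a1 (fst y) * deriv a2 (snd y)) + g y * (deriv a1 (fst y) * b2 (snd y))
          + g y * (b1 (fst y) * deriv a2 (snd y)) + g y * (b1 (fst y) * b2 (snd y))" for y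
        by (simp add: r_def algebra_simps)
      have grI: "integrable lborel (\<lambda>y. g y * r y)"
        unfolding gr using B11(1) B10(1) B01(1) B00(1) by auto
      have "(\<integral>y. g y * r y \<partial>lborel) \<le> M * M * N (1,1) + M * M * N (1,0) + M * M * N (0,1) + M * M * N (0,0)"
        unfolding gr using B11 B10 B01 B00 by simp
      also have "\<dots> = M * M * (\<Sum>\<alpha>\<in>corner_multis. N \<alpha>)"
      proof -
        have "corner_multis = {(0,0), (0,1), (1,0), (1,1)}" by auto
        then show ?thesis by (simp add: algebra_simps)
      qed
      finally have up: "(\<integral>y. g y * r y \<partial>lborel) \<le> M * M * (\<Sum>\<alpha>\<in>corner_multis. N \<alpha>)" .
      have rI: "has_bochner_integral lborel r 1"
        unfolding r_def using has_bochner_integral_tensor[OF 1(9) 2(9)] by simp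
      \<comment> \<open>Since \<open>r\<close> is nonnegative with mass 1, it is enough that
        \<open>g\<close> is at least \<open>g x - \<eta>\<close> on its support.\<close>
      have "g x - \<eta> = (\<integral>y. (g x - \<eta>) * r y \<partial>lborel)"
        using rI by (simp add: has_bochner_integral_iff)
      also have "\<dots> \<le> (\<integral>y. g y * r y \<partial>lborel)"
      proof (rule integral_mono)
        show "integrable lborel (\<lambda>y. (g x - \<eta>) * r y)" using rI by (simp add: has_bochner_integral_iff)
        show "(g x - \<eta>) * r y \<le> g y * r y" for y
        proof (cases "\<bar>fst y - fst x\<bar> \<le> e \<and> \<bar>snd y - snd x\<bar> \<le> e")
          case True
          have "dist y x \<le> \<bar>fst y - fst x\<bar> + \<bar>snd y - snd x\<bar>"
            unfolding dist_prod_def dist_real_def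
            using sqrt_sum_squares_le_sum_abs[of "fst y - fst x" "snd y - snd x"] by simp
          also have "\<dots> < \<delta>" using True e by linarith
          finally have "g x - \<eta> \<le> g y" using \<delta>(2)[of y] by linarith
          moreover have "r y \<ge> 0" unfolding r_def using 1(7) 2(7) by simp
          ultimately show ?thesis by (rule mult_right_mono)
        next
          case False
          then have "r y = 0" unfolding r_def using 1(8)[of "fst y"] 2(8)[of "snd y"] by auto
          then show ?thesis by simp
        qed
      qed (rule grI)
      finally show ?thesis using up by linarith
    qed
    then show "g x \<le> M * M * (\<Sum>\<alpha>\<in>corner_multis. LINT y:quadrant_box x s t|lborel. \<bar>h \<alpha> y\<bar>)"
      unfolding N_def by (rule field_le_epsilon)
  qed
qed

lemma has_weak_deriv_lincomb:
  assumes "has_weak_deriv \<alpha> g1 h1" "has_weak_deriv \<alpha> g2 h2"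
  shows "has_weak_deriv \<alpha> (\<lambda>x. c * g1 x + d * g2 x) (\<lambda>x. c * h1 x + d * h2 x)"
proof -
  have [measurable]: "h1 \<in> borel_measurable lborel" "h2 \<in> borel_measurable lborel"
    using assms by (auto simp: has_weak_deriv_def)
  have e: "(c * a + d * b) * p = c * (a * p) + d * (b * p)" for a b p :: real
    by (simp add: algebra_simps)
  show ?thesis
    using assms unfolding has_weak_deriv_def e by (auto simp: algebra_simps)
qed

lemma abs_le_eps_plus_square:
  fixes u :: real assumes "\<eta> > 0" shows "\<bar>u\<bar> \<le> \<eta> + u\<^sup>2 / \<eta>"
proof -
  have "0 \<le> (\<bar>u\<bar> - \<eta>)\<^sup>2" by simp
  then have "2 * (\<eta> * \<bar>u\<bar>) \<le> \<eta> * \<eta> + u\<^sup>2" by (simp add: power2_diff power2_eq_square algebra_simps)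
  moreover have "0 \<le> \<eta> * \<bar>u\<bar>" using assms by simp
  ultimately have "\<eta> * \<bar>u\<bar> \<le> \<eta> * \<eta> + u\<^sup>2" by linarith
  with assms show ?thesis by (simp add: field_simps)
qed

text \<open>\<open>abs_le_eps_plus_square\<close> stands in for the Cauchy-Schwarz inequality, and
  the area 4 of the box produces \<open>4 * \<eta>\<close>. The free parameter \<eta> is set to 1
  where a mere bound is wanted and taken small for decay.\<close>

lemma sobolev_quadrant:
  obtains C where "C > 0"
    "\<And>g h x s t \<eta>. continuous_on UNIV g \<Longrightarrow>
      (\<And>\<alpha>. \<alpha> \<in> corner_multis \<Longrightarrow> has_weak_deriv \<alpha> g (h \<alpha>)) \<Longrightarrow>
      (\<And>\<alpha>. \<alpha> \<in> corner_multis \<Longrightarrow> set_integrable lborel (quadrant_box x s t) (\<lambda>y. (h \<alpha> y)\<^sup>2)) \<Longrightarrow>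
      \<eta> > 0 \<Longrightarrow>
      \<bar>g x\<bar> \<le> C * (\<Sum>\<alpha>\<in>corner_multis. 4 * \<eta> + (LINT y:quadrant_box x s t|lborel. (h \<alpha> y)\<^sup>2) / \<eta>)"
proof -
  obtain C where C: "C > 0"
    "\<And>g h x s t. continuous_on UNIV g \<Longrightarrow>
      (\<And>\<alpha>. \<alpha> \<in> corner_multis \<Longrightarrow> has_weak_deriv \<alpha> g (h \<alpha>)) \<Longrightarrow>
      (\<And>\<alpha>. \<alpha> \<in> corner_multis \<Longrightarrow> set_integrable lborel (quadrant_box x s t) (h \<alpha>)) \<Longrightarrow>
      g x \<le> C * (\<Sum>\<alpha>\<in>corner_multis. LINT y:quadrant_box x s t|lborel. \<bar>h \<alpha> y\<bar>)"
    by (rule sobolev_quadrant_upper) blast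
  show thesis
  proof (rule that[OF C(1)])
    fix g :: "real \<times> real \<Rightarrow> real" and h x s t and \<eta> :: real
    assume cont: "continuous_on UNIV g" and \<eta>: "\<eta> > 0"
      and wd: "\<And>\<alpha>. \<alpha> \<in> corner_multis \<Longrightarrow> has_weak_deriv \<alpha> g (h \<alpha>)"
      and si: "\<And>\<alpha>. \<alpha> \<in> corner_multis \<Longrightarrow> set_integrable lborel (quadrant_box x s t) (\<lambda>y. (h \<alpha> y)\<^sup>2)"
    let ?B = "quadrant_box x s t"
    have "quadrant_box x s t = cbox (fst x - (if s then 0 else 2), snd x - (if t then 0 else 2))
        (fst x + (if s then 2 else 0), snd x + (if t then 2 else 0))"
      by (auto simp: quadrant_box_def side_def cbox_Pair_eq)
    then have em: "emeasure lborel ?B = 4" "measure lborel ?B = 4"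
      by (simp_all add: cbox_Pair_eq lborel_prod[symmetric] lborel.emeasure_pair_measure_Times measure_def
        flip: ennreal_mult' ennreal_numeral)
    have const: "set_integrable lborel ?B (\<lambda>y. c)" for c :: real
      using em by (simp add: set_integrable_def)
    have h: "set_integrable lborel ?B (h \<alpha>)"
      "(LINT y:?B|lborel. \<bar>h \<alpha> y\<bar>) \<le> 4 * \<eta> + (LINT y:?B|lborel. (h \<alpha> y)\<^sup>2) / \<eta>"
      if \<alpha>: "\<alpha> \<in> corner_multis" for \<alpha>
    proof -
      have [measurable]: "h \<alpha> \<in> borel_measurable borel"
        using wd[OF \<alpha>] by (simp add: has_weak_deriv_def)
      have dom: "set_integrable lborel ?B (\<lambda>y. \<eta> + (h \<alpha> y)\<^sup>2 / \<eta>)"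
        using set_integral_add(1)[OF const[of \<eta>] set_integrable_divide[OF si[OF \<alpha>]]] \<eta> by blast
      show 1: "set_integrable lborel ?B (h \<alpha>)"
        unfolding set_integrable_def
      proof (rule Bochner_Integration.integrable_bound[OF dom[unfolded set_integrable_def]])
        show "AE y in lborel. norm (indicat_real ?B y *\<^sub>R h \<alpha> y) \<le> norm (indicat_real ?B y *\<^sub>R (\<eta> + (h \<alpha> y)\<^sup>2 / \<eta>))"
          using abs_le_eps_plus_square[OF \<eta>]
          by (intro AE_I2) (auto split: split_indicator intro: order_trans[OF _ abs_ge_self])
      qed simp
      have "(LINT y:?B|lborel. \<bar>h \<alpha> y\<bar>) \<le> (LINT y:?B|lborel. \<eta> + (h \<alpha> y)\<^sup>2 / \<eta>)"
        by (rule set_integral_mono[OF set_integrable_abs[OF 1] dom]) (rule abs_le_eps_plus_square[OF \<eta>])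
      also have "\<dots> = (LINT y:?B|lborel. \<eta>) + (LINT y:?B|lborel. (h \<alpha> y)\<^sup>2 / \<eta>)"
        by (rule set_integral_add(2)[OF const set_integrable_divide[OF si[OF \<alpha>]]])
      also have "\<dots> = 4 * \<eta> + (LINT y:?B|lborel. (h \<alpha> y)\<^sup>2) / \<eta>"
        using em by (simp add: set_lebesgue_integral_def)
      finally show "(LINT y:?B|lborel. \<bar>h \<alpha> y\<bar>) \<le> 4 * \<eta> + (LINT y:?B|lborel. (h \<alpha> y)\<^sup>2) / \<eta>" .
    qed
    have neg: "has_weak_deriv \<alpha> (\<lambda>y. - g y) (\<lambda>y. - h \<alpha> y)" if "\<alpha> \<in> corner_multis" for \<alpha>
      using has_weak_deriv_lincomb[OF wd[OF that] wd[OF that], of "-1" 0] by simp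
    have "g x \<le> C * (\<Sum>\<alpha>\<in>corner_multis. LINT y:?B|lborel. \<bar>h \<alpha> y\<bar>)"
      by (rule C(2)[OF cont wd h(1)])
    moreover have "- g x \<le> C * (\<Sum>\<alpha>\<in>corner_multis. LINT y:?B|lborel. \<bar>- h \<alpha> y\<bar>)"
      by (rule C(2)[where g = "\<lambda>y. - g y" and h = "\<lambda>\<alpha> y. - h \<alpha> y"])
         (use cont neg h(1) in \<open>auto intro!: continuous_on_minus simp: set_integrable_def\<close>)
    ultimately have "\<bar>g x\<bar> \<le> C * (\<Sum>\<alpha>\<in>corner_multis. LINT y:?B|lborel. \<bar>h \<alpha> y\<bar>)" by simp
    also have "\<dots> \<le> C * (\<Sum>\<alpha>\<in>corner_multis. 4 * \<eta> + (LINT y:?B|lborel. (h \<alpha> y)\<^sup>2) / \<eta>)"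
      by (intro mult_left_mono sum_mono h(2)) (use C(1) in auto)
    finally show "\<bar>g x\<bar> \<le> C * (\<Sum>\<alpha>\<in>corner_multis. 4 * \<eta> + (LINT y:?B|lborel. (h \<alpha> y)\<^sup>2) / \<eta>)" .
  qed
qed

section \<open>The Sobolev spaces on the plane and on the torus\<close>

lemma dom_set_borel [measurable]: "dom_set D \<in> sets borel"
  by (cases D) (auto simp: dom_set_def borel_Times)

lemma set_integrable_square_lincomb:
  fixes u v :: "real \<times> real \<Rightarrow> real"
  assumes [measurable]: "u \<in> borel_measurable borel" "v \<in> borel_measurable borel" "A \<in> sets borel"
    and u: "set_integrable lborel A (\<lambda>x. (u x)\<^sup>2)" and v: "set_integrable lborel A (\<lambda>x. (v x)\<^sup>2)"
  shows "set_integrable lborel A (\<lambda>x. (c * u x + d * v x)\<^sup>2)" (is ?int)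
    and "(LINT x:A|lborel. (c * u x + d * v x)\<^sup>2) \<le>
      2 * c\<^sup>2 * (LINT x:A|lborel. (u x)\<^sup>2) + 2 * d\<^sup>2 * (LINT x:A|lborel. (v x)\<^sup>2)" (is ?le)
proof -
  have le: "(c * p + d * q)\<^sup>2 \<le> 2 * c\<^sup>2 * p\<^sup>2 + 2 * d\<^sup>2 * q\<^sup>2" for p q :: real
  proof -
    have "0 \<le> (c * p - d * q)\<^sup>2" by simp
    then show ?thesis by (simp add: power2_sum power2_diff power_mult_distrib)
  qed
  have u': "set_integrable lborel A (\<lambda>x. 2 * c\<^sup>2 * (u x)\<^sup>2)" and v': "set_integrable lborel A (\<lambda>x. 2 * d\<^sup>2 * (v x)\<^sup>2)"
    using u v by (auto intro: set_integrable_mult_right)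
  note dom = set_integral_add(1)[OF u' v']
  show ?int
    unfolding set_integrable_def
  proof (rule Bochner_Integration.integrable_bound[OF dom[unfolded set_integrable_def]])
    show "AE x in lborel. norm (indicat_real A x *\<^sub>R (c * u x + d * v x)\<^sup>2)
        \<le> norm (indicat_real A x *\<^sub>R (2 * c\<^sup>2 * (u x)\<^sup>2 + 2 * d\<^sup>2 * (v x)\<^sup>2))"
      by (intro AE_I2) (auto split: split_indicator intro: le)
  qed simp
  then have "(LINT x:A|lborel. (c * u x + d * v x)\<^sup>2) \<le>
      (LINT x:A|lborel. 2 * c\<^sup>2 * (u x)\<^sup>2 + 2 * d\<^sup>2 * (v x)\<^sup>2)"
    by (rule set_integral_mono[OF _ dom le])
  then show ?le by (simp add: set_integral_add(2)[OF u' v'])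
qed

lemma set_integral_nonneg_mono_set:
  fixes u :: "real \<times> real \<Rightarrow> real"
  assumes "set_integrable lborel B u" "A \<subseteq> B" "\<And>x. 0 \<le> u x"
  shows "(LINT x:A|lborel. u x) \<le> (LINT x:B|lborel. u x)"
  unfolding set_lebesgue_integral_def
  by (rule integral_mono') (use assms in \<open>auto simp: set_integrable_def split: split_indicator\<close>)

lemma in_Hk_lincomb:
  assumes "in_Hk D k g1" "in_Hk D k g2"
  shows "in_Hk D k (\<lambda>x. c * g1 x + d * g2 x)"
  unfolding in_Hk_def
proof (intro conjI allI impI)
  show "admissible D (\<lambda>x. c * g1 x + d * g2 x)"
    using assms by (cases D) (auto simp: in_Hk_def admissible_def)
  show "(\<lambda>x. c * g1 x + d * g2 x) \<in> borel_measurable lborel"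
    using assms by (auto simp: in_Hk_def)
  fix \<alpha> :: "nat \<times> nat" assume "fst \<alpha> + snd \<alpha> \<le> k"
  then obtain h1 h2 where h: "has_weak_deriv \<alpha> g1 h1" "set_integrable lborel (dom_set D) (\<lambda>x. (h1 x)\<^sup>2)"
    "has_weak_deriv \<alpha> g2 h2" "set_integrable lborel (dom_set D) (\<lambda>x. (h2 x)\<^sup>2)"
    using assms unfolding in_Hk_def by metis
  have "h1 \<in> borel_measurable borel" "h2 \<in> borel_measurable borel"
    using h by (auto simp: has_weak_deriv_def)
  then show "\<exists>h. has_weak_deriv \<alpha> (\<lambda>x. c * g1 x + d * g2 x) h \<and> set_integrable lborel (dom_set D) (\<lambda>x. (h x)\<^sup>2)"
    using has_weak_deriv_lincomb[OF h(1,3)] set_integrable_square_lincomb(1)[OF _ _ dom_set_borel h(2,4)]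
    by blast
qed

text \<open>\<open>in_Hk\<close> speaks of some square-integrable weak derivative,
  \<open>Hk_norm\<close> of the one picked by \<open>SOME\<close>. Uniqueness almost everywhere
  transfers square integrability to the picked one, so its integral in the norm is genuine and not
  the default 0.\<close>

lemma in_Hk_weak_deriv:
  assumes "in_Hk D k g" "fst \<alpha> + snd \<alpha> \<le> k"
  shows "has_weak_deriv \<alpha> g (weak_deriv \<alpha> g)"
    and "set_integrable lborel (dom_set D) (\<lambda>x. (weak_deriv \<alpha> g x)\<^sup>2)"
    and "(LINT x:dom_set D|lborel. (weak_deriv \<alpha> g x)\<^sup>2) \<le> (Hk_norm D k g)\<^sup>2"
proof -
  obtain h where h: "has_weak_deriv \<alpha> g h" "set_integrable lborel (dom_set D) (\<lambda>x. (h x)\<^sup>2)"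
    using assms unfolding in_Hk_def by blast
  show wd: "has_weak_deriv \<alpha> g (weak_deriv \<alpha> g)"
    unfolding weak_deriv_def by (rule someI[of _ h]) (rule h(1))
  have [measurable]: "weak_deriv \<alpha> g \<in> borel_measurable borel" "h \<in> borel_measurable borel"
    using h wd by (auto simp: has_weak_deriv_def)
  show "set_integrable lborel (dom_set D) (\<lambda>x. (weak_deriv \<alpha> g x)\<^sup>2)"
    unfolding set_integrable_def
  proof (rule integrable_cong_AE_imp[OF h(2)[unfolded set_integrable_def]])
    show "AE x in lborel. indicat_real (dom_set D) x *\<^sub>R (h x)\<^sup>2 =
        indicat_real (dom_set D) x *\<^sub>R (weak_deriv \<alpha> g x)\<^sup>2"
      using weak_deriv_unique_AE[OF h(1) wd] by eventually_elim simp
  qed simp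
  let ?S = "{\<alpha>. fst \<alpha> + snd \<alpha> \<le> k}"
  have "?S \<subseteq> {..k} \<times> {..k}" by auto
  then have fin: "finite ?S" by (rule finite_subset) simp
  have nonneg: "0 \<le> (LINT x:dom_set D|lborel. (weak_deriv \<beta> g x)\<^sup>2)" for \<beta>
    unfolding set_lebesgue_integral_def by (intro Bochner_Integration.integral_nonneg) simp
  have "(LINT x:dom_set D|lborel. (weak_deriv \<alpha> g x)\<^sup>2) \<le>
      (\<Sum>\<beta>\<in>?S. (LINT x:dom_set D|lborel. (weak_deriv \<beta> g x)\<^sup>2))"
    by (rule member_le_sum) (use assms(2) fin nonneg in auto)
  also have "\<dots> = (Hk_norm D k g)\<^sup>2"
    unfolding Hk_norm_def by (simp add: sum_nonneg nonneg)
  finally show "(LINT x:dom_set D|lborel. (weak_deriv \<alpha> g x)\<^sup>2) \<le> (Hk_norm D k g)\<^sup>2" .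
qed

section \<open>Moving a point into the fundamental square\<close>

lemma admissible_torus_shift:
  assumes "admissible Torus g"
  shows "g (a + 2 * pi * of_int m, b + 2 * pi * of_int n) = g (a, b)"
proof -
  have p: "g (a + 2 * pi, b) = g (a, b)" "g (a, b + 2 * pi) = g (a, b)" for a b
    using assms by (auto simp: admissible_def)
  have 1: "g (a + 2 * pi * of_int m, b) = g (a, b)" for a b
  proof (induction m rule: int_induct[of _ 0])
    case (step1 i)
    then show ?case using p(1)[of "a + 2 * pi * of_int i" b] by (simp add: algebra_simps)
  next
    case (step2 i)
    then show ?case using p(1)[of "a + 2 * pi * of_int (i - 1)" b] by (simp add: algebra_simps)
  qed simp
  have 2: "g (a, b + 2 * pi * of_int n) = g (a, b)" for a b
  proof (induction n rule: int_induct[of _ 0])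
    case (step1 i)
    then show ?case using p(2)[of a "b + 2 * pi * of_int i"] by (simp add: algebra_simps)
  next
    case (step2 i)
    then show ?case using p(2)[of a "b + 2 * pi * of_int (i - 1)"] by (simp add: algebra_simps)
  qed simp
  show ?thesis using 1 2 by simp
qed

text \<open>On the torus the norm controls only the fundamental square, so a point is moved there by
  periodicity and given a box that does not leave it.\<close>

lemma representative_with_box:
  "\<exists>y s u. (\<forall>g. admissible D g \<longrightarrow> g y = g x) \<and> quadrant_box y s u \<subseteq> dom_set D"
proof (cases D)
  case Plane
  then show ?thesis by (intro exI[of _ x]) (auto simp: dom_set_def)
next
  case Torus
  define red where "red = (\<lambda>a. a + 2 * pi * of_int (- \<lfloor>a / (2 * pi)\<rfloor>))"
  have red: "0 \<le> red a" "red a \<le> 2 * pi" for a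
  proof -
    define m where "m = \<lfloor>a / (2 * pi)\<rfloor>"
    have "of_int m \<le> a / (2 * pi)" "a / (2 * pi) \<le> of_int m + 1"
      unfolding m_def by linarith+
    then have "of_int m * (2 * pi) \<le> a" "a \<le> (of_int m + 1) * (2 * pi)"
      by (simp_all only: pos_le_divide_eq pos_divide_le_eq pi_gt_zero zero_less_mult_iff zero_less_numeral simp_thms)
    then show "0 \<le> red a" "red a \<le> 2 * pi"
      unfolding red_def m_def[symmetric] by (simp_all add: algebra_simps)
  qed
  \<comment> \<open>From the left half the interval points right, otherwise left, and
    \<open>2 \<le> pi\<close> keeps it inside.\<close>
  have side: "side (red a) (red a \<le> pi) \<subseteq> {0..2 * pi}" for a
    using red[of a] pi_ge_two by (auto simp: side_def split: if_splits)
  show ?thesis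
  proof (intro exI conjI allI impI)
    show "g (red (fst x), red (snd x)) = g x" if "admissible D g" for g
      using admissible_torus_shift[of g "fst x" _ "snd x"] that Torus by (simp only: red_def) simp
    show "quadrant_box (red (fst x), red (snd x)) (red (fst x) \<le> pi) (red (snd x) \<le> pi) \<subseteq> dom_set D"
      using side Torus by (auto simp: quadrant_box_def dom_set_def)
  qed
qed

section \<open>Consequences of the embedding: Lipschitz dependence on time, decay, attained
  maxima\<close>

lemma C1_Hk_locally_lipschitz:
  assumes C1: "C1_Hk D k T f" and "k \<ge> 2" and t: "t \<in> {0..T}"
    and cont: "\<And>s. s \<in> {0..T} \<Longrightarrow> continuous_on UNIV (f s)"
  shows "\<exists>C \<delta>. 0 < \<delta> \<and> (\<forall>s\<in>{0..T}. \<bar>s - t\<bar> < \<delta> \<longrightarrow> (\<forall>x. \<bar>f s x - f t x\<bar> \<le> C * \<bar>s - t\<bar>))"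
proof -
  obtain C0 where C0: "C0 > 0"
    "\<And>g h x s t \<eta>. continuous_on UNIV g \<Longrightarrow>
      (\<And>\<alpha>. \<alpha> \<in> corner_multis \<Longrightarrow> has_weak_deriv \<alpha> g (h \<alpha>)) \<Longrightarrow>
      (\<And>\<alpha>. \<alpha> \<in> corner_multis \<Longrightarrow> set_integrable lborel (quadrant_box x s t) (\<lambda>y. (h \<alpha> y)\<^sup>2)) \<Longrightarrow>
      \<eta> > 0 \<Longrightarrow>
      \<bar>g x\<bar> \<le> C0 * (\<Sum>\<alpha>\<in>corner_multis. 4 * \<eta> + (LINT y:quadrant_box x s t|lborel. (h \<alpha> y)\<^sup>2) / \<eta>)"
    by (rule sobolev_quadrant) blast
  have fH: "in_Hk D k (f s)" if "s \<in> {0..T}" for s using C1 that by (simp add: C1_Hk_def)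
  obtain f' where f': "\<And>s. s \<in> {0..T} \<Longrightarrow> in_Hk D k (f' s)"
    and lim: "((\<lambda>s. Hk_norm D k (\<lambda>x. (f s x - f t x) / (s - t) - f' t x)) \<longlongrightarrow> 0) (at t within {0..T})"
    using C1 t unfolding C1_Hk_def by blast
  from tendstoD[OF lim, of 1]
  obtain \<delta> where \<delta>: "\<delta> > 0" "\<And>s. s \<in> {0..T} \<Longrightarrow> s \<noteq> t \<Longrightarrow> \<bar>s - t\<bar> < \<delta> \<Longrightarrow>
      \<bar>Hk_norm D k (\<lambda>x. (f s x - f t x) / (s - t) - f' t x)\<bar> < 1"
    unfolding eventually_at by (auto simp: dist_real_def)
  define E where "E = (\<lambda>\<alpha>. LINT y:dom_set D|lborel. (weak_deriv \<alpha> (f' t) y)\<^sup>2)"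
  \<comment> \<open>The 4 is \<open>4 * \<eta>\<close> at \<open>\<eta> = 1\<close>. The rest comes
    from \<open>(u + v)\<^sup>2 \<le> 2 * u\<^sup>2 + 2 * v\<^sup>2\<close>, with the error of the
    difference quotient, of norm at most 1, as \<open>u\<close> and \<open>f' t\<close> as
    \<open>v\<close>.\<close>
  define C where "C = C0 * (\<Sum>\<alpha>\<in>corner_multis. 4 + (2 + 2 * E \<alpha>))"
  have "\<bar>f s x - f t x\<bar> \<le> C * \<bar>s - t\<bar>" if s: "s \<in> {0..T}" "\<bar>s - t\<bar> < \<delta>" for s x
  proof (cases "s = t")
    case False
    \<comment> \<open>The difference quotient splits as \<open>g = q + f' t\<close>. Near
      \<open>t\<close> the error \<open>q\<close> has norm below 1 and \<open>f' t\<close> does not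
      depend on \<open>s\<close>, so the Sobolev bound for \<open>g\<close> is uniform in
      \<open>s\<close> and \<open>x\<close>.\<close>
    define q where "q = (\<lambda>x. (f s x - f t x) / (s - t) - f' t x)"
    define g where "g = (\<lambda>x. (f s x - f t x) / (s - t))"
    have q_eq: "q = (\<lambda>x. 1 * ((1 / (s - t)) * f s x + (- 1 / (s - t)) * f t x) + (-1) * f' t x)"
      by (auto simp: q_def diff_divide_distrib)
    have qH: "in_Hk D k q" unfolding q_eq by (intro in_Hk_lincomb fH f' s t)
    have adm: "admissible D g"
    proof -
      have "in_Hk D k (\<lambda>x. (1 / (s - t)) * f s x + (- 1 / (s - t)) * f t x)"
        by (intro in_Hk_lincomb fH s t)
      then show ?thesis by (simp add: in_Hk_def g_def diff_divide_distrib)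
    qed
    have qnorm: "(Hk_norm D k q)\<^sup>2 \<le> 1"
      using \<delta>(2)[OF s(1) False s(2)] unfolding q_def[symmetric] by (simp add: abs_square_le_1)
    define h where "h = (\<lambda>\<alpha> y. 1 * weak_deriv \<alpha> q y + 1 * weak_deriv \<alpha> (f' t) y)"
    have deg: "fst \<alpha> + snd \<alpha> \<le> k" if "\<alpha> \<in> corner_multis" for \<alpha> using that \<open>k \<ge> 2\<close> by auto
    have gq: "g = (\<lambda>x. 1 * q x + 1 * f' t x)" by (simp add: g_def q_def)
    have hw: "has_weak_deriv \<alpha> g (h \<alpha>)" if "\<alpha> \<in> corner_multis" for \<alpha>
      unfolding gq h_def
      by (intro has_weak_deriv_lincomb in_Hk_weak_deriv(1)[OF qH] in_Hk_weak_deriv(1)[OF f'] deg that t)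
    have hs: "set_integrable lborel (dom_set D) (\<lambda>y. (h \<alpha> y)\<^sup>2)"
      "(LINT y:dom_set D|lborel. (h \<alpha> y)\<^sup>2) \<le> 2 + 2 * E \<alpha>" if "\<alpha> \<in> corner_multis" for \<alpha>
    proof -
      note Q = in_Hk_weak_deriv[OF qH deg[OF that]] and F = in_Hk_weak_deriv[OF f'[OF t] deg[OF that]]
      have m: "weak_deriv \<alpha> q \<in> borel_measurable borel" "weak_deriv \<alpha> (f' t) \<in> borel_measurable borel"
        using Q(1) F(1) by (auto simp: has_weak_deriv_def)
      show "set_integrable lborel (dom_set D) (\<lambda>y. (h \<alpha> y)\<^sup>2)"
        unfolding h_def by (rule set_integrable_square_lincomb(1)[OF m dom_set_borel Q(2) F(2)])
      have "(LINT y:dom_set D|lborel. (h \<alpha> y)\<^sup>2) \<le>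
          2 * 1\<^sup>2 * (LINT y:dom_set D|lborel. (weak_deriv \<alpha> q y)\<^sup>2) + 2 * 1\<^sup>2 * E \<alpha>"
        unfolding h_def E_def by (rule set_integrable_square_lincomb(2)[OF m dom_set_borel Q(2) F(2)])
      then show "(LINT y:dom_set D|lborel. (h \<alpha> y)\<^sup>2) \<le> 2 + 2 * E \<alpha>"
        using Q(3) qnorm by simp
    qed
    obtain y a b where y: "\<And>g. admissible D g \<Longrightarrow> g y = g x" "quadrant_box y a b \<subseteq> dom_set D"
      using representative_with_box[of D x] by blast
    have hb: "set_integrable lborel (quadrant_box y a b) (\<lambda>y. (h \<alpha> y)\<^sup>2)"
      if "\<alpha> \<in> corner_multis" for \<alpha>
      by (rule set_integrable_subset[OF hs(1)[OF that] _ y(2)]) simp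
    have "\<bar>g y\<bar> \<le> C0 * (\<Sum>\<alpha>\<in>corner_multis. 4 * 1 + (LINT z:quadrant_box y a b|lborel. (h \<alpha> z)\<^sup>2) / 1)"
    proof (rule C0(2)[OF _ hw hb])
      show "continuous_on UNIV g"
        unfolding g_def by (intro continuous_intros cont s t) (use False in auto)
    qed auto
    also have "\<dots> \<le> C0 * (\<Sum>\<alpha>\<in>corner_multis. 4 + (2 + 2 * E \<alpha>))"
    proof (intro mult_left_mono sum_mono)
      fix \<alpha> assume \<alpha>: "\<alpha> \<in> corner_multis"
      have "(LINT z:quadrant_box y a b|lborel. (h \<alpha> z)\<^sup>2) \<le> (LINT z:dom_set D|lborel. (h \<alpha> z)\<^sup>2)"
        by (rule set_integral_nonneg_mono_set[OF hs(1)[OF \<alpha>]]) (use y(2) in auto)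
      then show "4 * 1 + (LINT z:quadrant_box y a b|lborel. (h \<alpha> z)\<^sup>2) / 1 \<le> 4 + (2 + 2 * E \<alpha>)"
        using hs(2)[OF \<alpha>] by simp
    qed (use C0(1) in auto)
    finally have "\<bar>g x\<bar> \<le> C" using y(1)[OF adm] by (simp add: C_def)
    then have "\<bar>g x\<bar> * \<bar>s - t\<bar> \<le> C * \<bar>s - t\<bar>" by (rule mult_right_mono) simp
    then show ?thesis using False by (simp add: g_def abs_divide)
  qed simp
  with \<delta>(1) show ?thesis by blast
qed

text \<open>For a box far out, the integrals in the Sobolev bound are at most tails of convergent
  integrals; the remaining terms are multiples of \<eta>, which is fixed small beforehand.\<close>

lemma in_Hk_Plane_decay:
  assumes g: "in_Hk Plane k g" and "k \<ge> 2" and cont: "continuous_on UNIV g" and "e > 0"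
  shows "\<exists>R. \<forall>x. norm x > R \<longrightarrow> \<bar>g x\<bar> < e"
proof -
  obtain C where C: "C > 0"
    "\<And>g h x s t \<eta>. continuous_on UNIV g \<Longrightarrow>
      (\<And>\<alpha>. \<alpha> \<in> corner_multis \<Longrightarrow> has_weak_deriv \<alpha> g (h \<alpha>)) \<Longrightarrow>
      (\<And>\<alpha>. \<alpha> \<in> corner_multis \<Longrightarrow> set_integrable lborel (quadrant_box x s t) (\<lambda>y. (h \<alpha> y)\<^sup>2)) \<Longrightarrow>
      \<eta> > 0 \<Longrightarrow>
      \<bar>g x\<bar> \<le> C * (\<Sum>\<alpha>\<in>corner_multis. 4 * \<eta> + (LINT y:quadrant_box x s t|lborel. (h \<alpha> y)\<^sup>2) / \<eta>)"
    by (rule sobolev_quadrant) blast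
  define h where "h = (\<lambda>\<alpha>. weak_deriv \<alpha> g)"
  have deg: "fst \<alpha> + snd \<alpha> \<le> k" if "\<alpha> \<in> corner_multis" for \<alpha> using that \<open>k \<ge> 2\<close> by auto
  have hw: "has_weak_deriv \<alpha> g (h \<alpha>)" if "\<alpha> \<in> corner_multis" for \<alpha>
    unfolding h_def by (rule in_Hk_weak_deriv(1)[OF g deg[OF that]])
  have hs: "set_integrable lborel UNIV (\<lambda>y. (h \<alpha> y)\<^sup>2)" if "\<alpha> \<in> corner_multis" for \<alpha>
    using in_Hk_weak_deriv(2)[OF g deg[OF that]] by (simp add: dom_set_def h_def)
  \<comment> \<open>Four terms \<open>4 * \<eta>\<close> times \<open>C\<close> make
    \<open>e / 2\<close>; the tail threshold \<open>\<eta> * (e / (2 * C))\<close> supplies the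
    other half.\<close>
  define \<eta> where "\<eta> = e / (32 * C)"
  have \<eta>: "\<eta> > 0" using C \<open>e > 0\<close> by (simp add: \<eta>_def)
  define A where "A = (\<lambda>n. {y :: real \<times> real. norm y \<ge> real n})"
  have A [measurable]: "A n \<in> sets borel" for n unfolding A_def by measurable
  have "(\<lambda>n. LINT y:A n|lborel. (h \<alpha> y)\<^sup>2) \<longlonglongrightarrow> 0" if \<alpha>: "\<alpha> \<in> corner_multis" for \<alpha>
  proof -
    have [measurable]: "h \<alpha> \<in> borel_measurable borel" using hw[OF \<alpha>] by (simp add: has_weak_deriv_def)
    have "(\<lambda>n. \<integral>y. indicat_real (A n) y *\<^sub>R (h \<alpha> y)\<^sup>2 \<partial>lborel) \<longlonglongrightarrow> (\<integral>y. 0 \<partial>(lborel :: (real \<times> real) measure))"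
    proof (rule integral_dominated_convergence[where w = "\<lambda>y. (h \<alpha> y)\<^sup>2"])
      show "integrable lborel (\<lambda>y. (h \<alpha> y)\<^sup>2)" using hs[OF \<alpha>] by (simp add: set_integrable_def)
      show "AE y in lborel. (\<lambda>n. indicat_real (A n) y *\<^sub>R (h \<alpha> y)\<^sup>2) \<longlonglongrightarrow> 0"
      proof (rule AE_I2)
        fix y :: "real \<times> real"
        obtain m where m: "norm y < real m" using reals_Archimedean2 by blast
        have "indicat_real (A n) y *\<^sub>R (h \<alpha> y)\<^sup>2 = 0" if "n \<ge> m" for n
        proof -
          have "norm y < real n" using m that by linarith
          then show ?thesis by (simp add: A_def)
        qed
        then show "(\<lambda>n. indicat_real (A n) y *\<^sub>R (h \<alpha> y)\<^sup>2) \<longlonglongrightarrow> 0"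
          by (intro tendsto_eventually) (auto simp: eventually_sequentially)
      qed
    qed (auto split: split_indicator)
    then show ?thesis by (simp add: set_lebesgue_integral_def)
  qed
  then have "(\<lambda>n. \<Sum>\<alpha>\<in>corner_multis. LINT y:A n|lborel. (h \<alpha> y)\<^sup>2) \<longlonglongrightarrow> (\<Sum>\<alpha>\<in>corner_multis. 0)"
    by (intro tendsto_sum)
  then have "\<forall>\<^sub>F n in sequentially. (\<Sum>\<alpha>\<in>corner_multis. LINT y:A n|lborel. (h \<alpha> y)\<^sup>2) < \<eta> * (e / (2 * C))"
    by (rule order_tendstoD) (use \<eta> C \<open>e > 0\<close> in auto)
  then obtain n where n: "(\<Sum>\<alpha>\<in>corner_multis. LINT y:A n|lborel. (h \<alpha> y)\<^sup>2) < \<eta> * (e / (2 * C))"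
    by (auto simp: eventually_sequentially)
  \<comment> \<open>Points of the box differ from \<open>x\<close> by at most 2 in each coordinate,
    hence by at most 4 in norm.\<close>
  have "\<bar>g x\<bar> < e" if x: "norm x > real n + 4" for x
  proof -
    let ?B = "quadrant_box x True True"
    have sub: "?B \<subseteq> A n"
    proof
      fix y assume "y \<in> ?B"
      then have "\<bar>fst (x - y)\<bar> \<le> 2" "\<bar>snd (x - y)\<bar> \<le> 2"
        by (auto simp: quadrant_box_def side_def)
      moreover have "norm (x - y) \<le> \<bar>fst (x - y)\<bar> + \<bar>snd (x - y)\<bar>"
        using norm_Pair_le[of "fst (x - y)" "snd (x - y)"] by (simp only: prod.collapse real_norm_def)
      moreover have "norm x \<le> norm y + norm (x - y)" using norm_triangle_ineq[of y "x - y"] by simp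
      ultimately show "y \<in> A n" using x by (simp add: A_def)
    qed
    have hA: "set_integrable lborel (A n) (\<lambda>y. (h \<alpha> y)\<^sup>2)" if "\<alpha> \<in> corner_multis" for \<alpha>
      by (rule set_integrable_subset[OF hs[OF that]]) auto
    have hB: "set_integrable lborel ?B (\<lambda>y. (h \<alpha> y)\<^sup>2)" if "\<alpha> \<in> corner_multis" for \<alpha>
      by (rule set_integrable_subset[OF hs[OF that]]) auto
    have "\<bar>g x\<bar> \<le> C * (\<Sum>\<alpha>\<in>corner_multis. 4 * \<eta> + (LINT y:?B|lborel. (h \<alpha> y)\<^sup>2) / \<eta>)"
      by (rule C(2)[OF cont hw hB \<eta>])
    also have "\<dots> \<le> C * (\<Sum>\<alpha>\<in>corner_multis. 4 * \<eta> + (LINT y:A n|lborel. (h \<alpha> y)\<^sup>2) / \<eta>)"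
    proof (intro mult_left_mono sum_mono add_mono divide_right_mono order_refl)
      fix \<alpha> assume \<alpha>: "\<alpha> \<in> corner_multis"
      show "(LINT z:?B|lborel. (h \<alpha> z)\<^sup>2) \<le> (LINT z:A n|lborel. (h \<alpha> z)\<^sup>2)"
        by (rule set_integral_nonneg_mono_set[OF hA[OF \<alpha>]]) (use sub in auto)
    qed (use C(1) \<eta> in auto)
    also have "\<dots> = C * (16 * \<eta> + (\<Sum>\<alpha>\<in>corner_multis. LINT y:A n|lborel. (h \<alpha> y)\<^sup>2) / \<eta>)"
      by (simp add: sum.distrib sum_divide_distrib add_divide_distrib)
    also have "\<dots> < C * (16 * \<eta> + (\<eta> * (e / (2 * C))) / \<eta>)"
      by (intro mult_strict_left_mono add_strict_left_mono divide_strict_right_mono n \<eta> C)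
    also have "\<dots> = e" using C \<eta> by (simp add: \<eta>_def field_simps)
    finally show ?thesis .
  qed
  then show ?thesis by blast
qed

text \<open>On the plane, decay makes every value outside a large ball smaller than the given
  positive one, so compactness of the ball suffices; a supremum equal to 0 might be attained
  nowhere. On the torus compactness of the square does it.\<close>

lemma in_Hk_attains_positive_max:
  assumes g: "in_Hk D k g" and k: "k \<ge> 2" and cont: "continuous_on UNIV g" and pos: "g x0 > 0"
  shows "\<exists>x. \<forall>y. g y \<le> g x"
proof (cases D)
  case Plane
  obtain R where R: "\<And>x. norm x > R \<Longrightarrow> \<bar>g x\<bar> < g x0"
    using in_Hk_Plane_decay[of k g "g x0"] g k cont pos Plane by blast
  have x0: "x0 \<in> cball 0 R" using R[of x0] by (cases "norm x0 > R") auto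
  then have "0 \<le> R" using order_trans[OF norm_ge_zero[of x0]] by simp
  then have "cball (0 :: real \<times> real) R \<noteq> {}" by simp
  then have "\<exists>x\<in>cball 0 R. \<forall>y\<in>cball 0 R. g y \<le> g x"
    by (intro continuous_attains_sup compact_cball continuous_on_subset[OF cont] subset_UNIV)
  then obtain x where x: "\<And>y. y \<in> cball 0 R \<Longrightarrow> g y \<le> g x" by blast
  have "g y \<le> g x" for y
  proof (cases "norm y > R")
    case True
    then show ?thesis using R[of y] x[OF x0] by linarith
  qed (use x in auto)
  then show ?thesis by blast
next
  case Torus
  have "dom_set Torus \<noteq> {}" "compact (dom_set Torus)"
    by (auto simp: dom_set_def intro!: compact_Times)
  then have "\<exists>x\<in>dom_set Torus. \<forall>y\<in>dom_set Torus. g y \<le> g x"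
    by (intro continuous_attains_sup continuous_on_subset[OF cont]) auto
  then obtain x where x: "\<And>y. y \<in> dom_set Torus \<Longrightarrow> g y \<le> g x" by blast
  have "g y \<le> g x" for y
  proof -
    obtain z s u where z: "\<And>g. admissible D g \<Longrightarrow> g z = g y" "quadrant_box z s u \<subseteq> dom_set D"
      using representative_with_box[of D y] by blast
    have "z \<in> quadrant_box z s u" by (cases z) (simp add: quadrant_box_def side_def)
    then have "z \<in> dom_set Torus" using z(2) Torus by blast
    moreover have "g z = g y" by (rule z(1)) (use g in \<open>simp add: in_Hk_def\<close>)
    ultimately show ?thesis using x[of z] by simp
  qed
  then show ?thesis by blast
qed

section \<open>The sign of the principal value at an extremum\<close>

lemma has_bochner_integral_lborel_scaleR:
  fixes f :: "real \<times> real \<Rightarrow> real"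
  assumes "has_bochner_integral lborel f I" "c > 0"
  shows "has_bochner_integral lborel (\<lambda>z. f (c *\<^sub>R z)) (I / c\<^sup>2)"
proof -
  have [measurable]: "f \<in> borel_measurable borel"
    using assms(1) has_bochner_integral_iff borel_measurable_integrable by fastforce
  have "has_bochner_integral (density (distr lborel borel (\<lambda>x. 0 + c *\<^sub>R x)) (\<lambda>_. ennreal (c\<^sup>2))) f I"
    using assms lborel_affine[of c "0 :: real \<times> real"] by (simp add: power2_eq_square ennreal_mult)
  then have "has_bochner_integral lborel (\<lambda>z. c\<^sup>2 * f (c *\<^sub>R z)) I"
    by (simp add: has_bochner_integral_density has_bochner_integral_distr has_bochner_integral_iff
      integrable_density integral_density integrable_distr_eq integral_distr)
  then have "has_bochner_integral lborel (\<lambda>z. (c\<^sup>2 * f (c *\<^sub>R z)) / c\<^sup>2) (I / c\<^sup>2)"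
    by (rule has_bochner_integral_divide)
  with assms(2) show ?thesis by simp
qed

text \<open>Polar coordinates without a Jacobian: weighting \<open>H y\<close> by \<open>1/l\<close> on
  \<open>l \<le> norm y \<le> 2 * l\<close> and substituting \<open>y = l *\<^sub>R z\<close> turns the integral of \<open>H\<close>
  into an average over \<open>1 \<le> norm z \<le> 2\<close> of integrals along rays.\<close>
lemma integral_nonpos_if_nonpos_on_rays:
  fixes H :: "real \<times> real \<Rightarrow> real"
  assumes H: "integrable lborel H"
    and ray: "\<And>z. z \<noteq> 0 \<Longrightarrow> (\<integral>l. indicator {0<..} l * (l * H (l *\<^sub>R z)) \<partial>lborel) \<le> 0"
  shows "integral\<^sup>L lborel H \<le> 0"
proof -
  have [measurable]: "H \<in> borel_measurable borel"
    using H borel_measurable_integrable by fastforce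
  define w where "w = (\<lambda>(l::real) (y::real \<times> real).
    if 0 < l \<and> l \<le> norm y \<and> norm y \<le> 2 * l then 1 / l else 0)"
  have wm [measurable]: "(\<lambda>p. w (fst p) (snd p)) \<in> borel_measurable (borel \<Otimes>\<^sub>M borel)"
    unfolding w_def by measurable
  have w0: "w l y \<ge> 0" for l y by (auto simp: w_def)
  have wint: "has_bochner_integral lborel (\<lambda>l. w l y) (ln 2)" if "y \<noteq> 0" for y
  proof -
    \<comment> \<open>The weight is nonzero exactly for \<open>l\<close> between
      \<open>norm y / 2\<close> and \<open>norm y\<close>. As \<open>1 / l\<close> is scale
      invariant, the integral is \<open>ln 2\<close> for every \<open>y \<noteq> 0\<close>.\<close>
    have "has_bochner_integral lborel (\<lambda>l. (1 / l) * indicator {norm y / 2 .. norm y} l)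
        (ln (norm y) - ln (norm y / 2))"
    proof (rule has_bochner_integral_FTC_Icc_nonneg)
      fix l assume "l \<in> {norm y / 2..norm y}"
      then have "l > 0" using that
        by (metis atLeastAtMost_iff half_gt_zero less_le_trans zero_less_norm_iff)
      then show "DERIV ln l :> 1 / l" "0 \<le> 1 / l"
        by (auto intro!: derivative_eq_intros)
    qed (use that in auto)
    also have "(\<lambda>l. (1 / l) * indicator {norm y / 2 .. norm y} l) = (\<lambda>l. w l y)"
    proof
      fix l
      have "norm y > 0" using that by simp
      then show "(1 / l) * indicator {norm y / 2 .. norm y} l = w l y"
        by (auto simp: w_def split: split_indicator)
    qed
    also have "ln (norm y) - ln (norm y / 2) = ln 2"
      using that by (simp add: ln_div)
    finally show ?thesis .
  qed
  have ae0: "AE y in lborel. y \<noteq> (0 :: real \<times> real)" by (rule AE_lborel_singleton)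
  have Kint: "integrable (lborel \<Otimes>\<^sub>M lborel) (\<lambda>(y, l). H y * w l y)"
  proof (rule lborel_pair.Fubini_integrable)
    show "(\<lambda>(y, l). H y * w l y) \<in> borel_measurable (lborel \<Otimes>\<^sub>M lborel)"
      using measurable_compose[OF measurable_Pair[OF measurable_snd measurable_fst] wm]
      by (simp add: case_prod_beta cong: measurable_cong_sets)
    have "integrable lborel (\<lambda>y. \<bar>H y\<bar> * ln 2)" using H by auto
    then show "integrable lborel (\<lambda>y. \<integral>l. norm (case (y, l) of (y, l) \<Rightarrow> H y * w l y) \<partial>lborel)"
    proof (rule integrable_cong_AE_imp)
      show "AE y in lborel. \<bar>H y\<bar> * ln 2 = (\<integral>l. norm (case (y, l) of (y, l) \<Rightarrow> H y * w l y) \<partial>lborel)"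
        using ae0
      proof eventually_elim
        case (elim y)
        have "(\<lambda>l. norm (case (y, l) of (y, l) \<Rightarrow> H y * w l y)) = (\<lambda>l. \<bar>H y\<bar> * w l y)"
          using w0 by (simp add: abs_mult)
        then show ?case using has_bochner_integral_integral_eq[OF wint[OF elim]] by simp
      qed
      have "(\<lambda>p. norm (H (fst p) * w (snd p) (fst p))) \<in> borel_measurable (borel \<Otimes>\<^sub>M lborel)"
        using measurable_compose[OF measurable_Pair[OF measurable_snd measurable_fst] wm]
        by (simp cong: measurable_cong_sets)
      then have "(\<lambda>y. \<integral>l. norm (H y * w l y) \<partial>lborel) \<in> borel_measurable borel"
        by (intro sigma_finite_measure.borel_measurable_lebesgue_integral)
           (auto simp: case_prod_beta sigma_finite_lborel)
      then show "(\<lambda>y. \<integral>l. norm (case (y, l) of (y, l) \<Rightarrow> H y * w l y) \<partial>lborel) \<in> borel_measurable lborel"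
        by simp
    qed
    show "AE y in lborel. integrable lborel (\<lambda>l. case (y, l) of (y, l) \<Rightarrow> H y * w l y)"
      using ae0
    proof eventually_elim
      case (elim y)
      then show ?case using wint[OF elim] by (simp add: has_bochner_integral_iff)
    qed
  qed
  have Kval: "(\<integral>y. (\<integral>l. H y * w l y \<partial>lborel) \<partial>lborel) = ln 2 * integral\<^sup>L lborel H"
  proof -
    have "(\<integral>y. (\<integral>l. H y * w l y \<partial>lborel) \<partial>lborel) = (\<integral>y. H y * ln 2 \<partial>lborel)"
    proof (rule integral_cong_AE)
      show "AE y in lborel. (\<integral>l. H y * w l y \<partial>lborel) = H y * ln 2"
        using ae0 by eventually_elim (use has_bochner_integral_integral_eq[OF wint] in simp)
      show "(\<lambda>y. \<integral>l. H y * w l y \<partial>lborel) \<in> borel_measurable lborel"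
        using lborel_pair.integrable_fst'[OF Kint] by simp
    qed auto
    then show ?thesis by simp
  qed
  have Kswap: "integrable (lborel \<Otimes>\<^sub>M lborel) (\<lambda>(l, y). H y * w l y)"
    using lborel_pair.integrable_product_swap[OF Kint] by (simp add: case_prod_beta)
  have aeK: "AE l in lborel. integrable lborel (\<lambda>y. H y * w l y)"
    using lborel_pair.AE_integrable_fst'[OF Kswap] by simp
  \<comment> \<open>Under \<open>y = l *\<^sub>R z\<close> the Jacobian \<open>l\<^sup>2\<close> and
    the weight \<open>1 / l\<close> leave the factor \<open>l\<close>, and the condition on
    \<open>norm y\<close> becomes an annulus in \<open>z\<close> that is the same for all
    \<open>l\<close>.\<close>
  define K' where "K' = (\<lambda>l z. indicator {0<..} l * (l * H (l *\<^sub>R z)) *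
      indicator {z :: real \<times> real. 1 \<le> norm z \<and> norm z \<le> 2} z)"
  have K'eq: "K' l z = l\<^sup>2 * (H (l *\<^sub>R z) * w l (l *\<^sub>R z))" if "l > 0" for l z
    using that by (auto simp: K'_def w_def power2_eq_square split: split_indicator)
  have K'0: "K' l z = 0" if "l \<le> 0" for l z using that by (simp add: K'_def)
  \<comment> \<open>The norms are carried along because joint integrability of \<open>K'\<close> is
    inferred from that of the weighted \<open>H\<close>.\<close>
  have slice: "has_bochner_integral lborel (\<lambda>z. K' l z) (\<integral>y. H y * w l y \<partial>lborel) \<and>
      (\<integral>z. norm (K' l z) \<partial>lborel) = (\<integral>y. norm (H y * w l y) \<partial>lborel)"
    if int: "integrable lborel (\<lambda>y. H y * w l y)" for l
  proof (cases "l > 0")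
    case True
    have 1: "has_bochner_integral lborel (\<lambda>z. K' l z) (l\<^sup>2 * ((\<integral>y. H y * w l y \<partial>lborel) / l\<^sup>2))"
      unfolding K'eq[OF True] using int True
      by (intro has_bochner_integral_mult_right has_bochner_integral_lborel_scaleR
          has_bochner_integral_integrable) auto
    have "has_bochner_integral lborel (\<lambda>z. l\<^sup>2 * norm (H (l *\<^sub>R z) * w l (l *\<^sub>R z)))
        (l\<^sup>2 * ((\<integral>y. norm (H y * w l y) \<partial>lborel) / l\<^sup>2))"
      using int True
      by (intro has_bochner_integral_mult_right
          has_bochner_integral_lborel_scaleR[where f = "\<lambda>y. norm (H y * w l y)"]
          has_bochner_integral_integrable integrable_norm) auto
    also have "(\<lambda>z. l\<^sup>2 * norm (H (l *\<^sub>R z) * w l (l *\<^sub>R z))) = (\<lambda>z. norm (K' l z))"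
      unfolding K'eq[OF True] by (simp add: abs_mult)
    finally show ?thesis using 1 True has_bochner_integral_integral_eq by fastforce
  next
    case False
    then show ?thesis by (simp add: K'0 w_def has_bochner_integral_zero)
  qed
  have K'int: "integrable (lborel \<Otimes>\<^sub>M lborel) (\<lambda>(l, z). K' l z)"
  proof (rule lborel_pair.Fubini_integrable)
    have K'm: "(\<lambda>(l, z). K' l z) \<in> borel_measurable (borel \<Otimes>\<^sub>M borel)"
      unfolding K'_def by measurable
    then show "(\<lambda>(l, z). K' l z) \<in> borel_measurable (lborel \<Otimes>\<^sub>M lborel)"
      by (simp cong: measurable_cong_sets)
    have "integrable lborel (\<lambda>l. \<integral>y. norm (H y * w l y) \<partial>lborel)"
      using lborel_pair.integrable_fst'[OF integrable_norm[OF Kswap]] by simp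
    then show "integrable lborel (\<lambda>l. \<integral>z. norm (case (l, z) of (l, z) \<Rightarrow> K' l z) \<partial>lborel)"
    proof (rule integrable_cong_AE_imp)
      show "AE l in lborel. (\<integral>y. norm (H y * w l y) \<partial>lborel)
          = (\<integral>z. norm (case (l, z) of (l, z) \<Rightarrow> K' l z) \<partial>lborel)"
        using aeK by eventually_elim (use slice in simp)
      have "(\<lambda>(l, z). norm (K' l z)) \<in> borel_measurable (borel \<Otimes>\<^sub>M lborel)"
        using K'm by (simp add: case_prod_beta cong: measurable_cong_sets)
      then have "(\<lambda>l. \<integral>z. norm (K' l z) \<partial>lborel) \<in> borel_measurable borel"
        by (intro sigma_finite_measure.borel_measurable_lebesgue_integral)
           (auto simp: sigma_finite_lborel)
      then show "(\<lambda>l. \<integral>z. norm (case (l, z) of (l, z) \<Rightarrow> K' l z) \<partial>lborel) \<in> borel_measurable lborel"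
        by simp
    qed
    show "AE l in lborel. integrable lborel (\<lambda>z. case (l, z) of (l, z) \<Rightarrow> K' l z)"
      using aeK by eventually_elim (use slice in \<open>simp add: has_bochner_integral_iff\<close>)
  qed
  have "ln 2 * integral\<^sup>L lborel H = (\<integral>l. (\<integral>y. H y * w l y \<partial>lborel) \<partial>lborel)"
    unfolding Kval[symmetric] by (rule lborel_pair.Fubini_integral[OF Kswap])
  also have "\<dots> = (\<integral>l. (\<integral>z. K' l z \<partial>lborel) \<partial>lborel)"
  proof (rule integral_cong_AE)
    show "AE l in lborel. (\<integral>y. H y * w l y \<partial>lborel) = (\<integral>z. K' l z \<partial>lborel)"
      using aeK by eventually_elim (use slice in \<open>simp add: has_bochner_integral_iff\<close>)
    show "(\<lambda>l. \<integral>y. H y * w l y \<partial>lborel) \<in> borel_measurable lborel"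
      using lborel_pair.integrable_fst'[OF Kswap] by simp
    show "(\<lambda>l. \<integral>z. K' l z \<partial>lborel) \<in> borel_measurable lborel"
      using lborel_pair.integrable_fst'[OF K'int] by simp
  qed
  also have "\<dots> = (\<integral>z. (\<integral>l. K' l z \<partial>lborel) \<partial>lborel)"
    by (rule lborel_pair.Fubini_integral[OF K'int, symmetric])
  also have "\<dots> \<le> 0"
  proof -
    have "(\<integral>l. K' l z \<partial>lborel) \<le> 0" for z
    proof (cases "z = 0")
      case False
      have "(\<integral>l. K' l z \<partial>lborel) = (\<integral>l. indicator {0<..} l * (l * H (l *\<^sub>R z)) \<partial>lborel) *
          indicator {z :: real \<times> real. 1 \<le> norm z \<and> norm z \<le> 2} z"
        unfolding K'_def by simp
      also have "\<dots> \<le> 0" using ray[OF False] by (auto split: split_indicator)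
      finally show ?thesis .
    qed (simp add: K'_def)
    then have "0 \<le> (\<integral>z. - (\<integral>l. K' l z \<partial>lborel) \<partial>lborel)"
      by (intro Bochner_Integration.integral_nonneg) simp
    then show ?thesis by simp
  qed
  finally show ?thesis using mult_pos_pos[of "ln 2" "integral\<^sup>L lborel H"] by fastforce
qed

section \<open>The kernel along rays from an extremum\<close>

lemma grad2_inner:
  assumes "(g has_derivative g') (at p)"
  shows "grad2 g p \<bullet> y = g' y"
proof -
  have lin: "linear g'" using assms has_derivative_linear by blast
  have pd: "pd i g p = g' (axis2 i)" for i
    unfolding pd_def
  proof (rule DERIV_imp_deriv)
    have "((\<lambda>s. p + s *\<^sub>R axis2 i) has_derivative (\<lambda>s. s *\<^sub>R axis2 i)) (at 0)"
      by (auto intro!: derivative_eq_intros)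
    moreover have "(g has_derivative g') (at (p + 0 *\<^sub>R axis2 i))" using assms by simp
    ultimately have "((\<lambda>s. g (p + s *\<^sub>R axis2 i)) has_derivative (\<lambda>s. g' (s *\<^sub>R axis2 i))) (at 0)"
      by (rule has_derivative_compose)
    then show "((\<lambda>s. g (p + s *\<^sub>R axis2 i)) has_real_derivative g' (axis2 i)) (at 0)"
      by (simp add: has_field_derivative_def linear_cmul[OF lin] mult_commute_abs)
  qed
  have "y = fst y *\<^sub>R axis2 0 + snd y *\<^sub>R axis2 1" by (simp add: axis2_def prod_eq_iff)
  from arg_cong[OF this, of g'] have "g' y = fst y * g' (axis2 0) + snd y * g' (axis2 1)"
    by (simp only: linear_add[OF lin] linear_cmul[OF lin] real_scaleR_def)
  then show ?thesis by (cases y) (simp add: grad2_def pd mult.commute)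
qed

lemma grad2_eq_0_at_max:
  assumes "g differentiable (at x)" "\<And>y. g y \<le> g x"
  shows "grad2 g x = 0"
proof -
  have "(\<lambda>s. g (x + s *\<^sub>R axis2 i)) differentiable (at 0)" for i
    using differentiable_chain_at[of "\<lambda>s::real. x + s *\<^sub>R axis2 i" 0 g] assms(1)
    by (simp add: o_def)
  then obtain d where d: "((\<lambda>s. g (x + s *\<^sub>R axis2 i)) has_real_derivative d i) (at 0)" for i
    unfolding real_differentiable_def by metis
  then have "d i = 0" for i
    by (rule DERIV_local_max[of _ _ _ 1]) (use assms(2) in auto)
  with d have "pd i g x = 0" for i unfolding pd_def by (metis DERIV_imp_deriv)
  then show ?thesis by (simp add: grad2_def zero_prod_def)
qed

text \<open>With \<open>G l = g x - g (x - l z) \<ge> 0\<close> and \<open>\<Psi> l = G l / sqrt (l\<^sup>2 |z|\<^sup>2 + (G l)\<^sup>2)\<close>, the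
  integrand along the ray is at most \<open>- \<Psi>' l / |z|\<^sup>2\<close>, and \<open>\<Psi> l\<close> tends to 0 as \<open>l\<close>
  decreases to 0 because the gradient vanishes at the maximum.\<close>
lemma kernel_ray_integral_nonpos:
  fixes g :: "real \<times> real \<Rightarrow> real"
  assumes diff: "\<And>p. g differentiable (at p)" and max: "\<And>y. g y \<le> g x" and z: "z \<noteq> 0" and "b \<ge> 0"
    and hi: "((\<lambda>l. l * kernel g x (l *\<^sub>R z)) has_integral I) {0..b}"
  shows "I \<le> 0"
proof -
  define g' where "g' = (\<lambda>p. frechet_derivative g (at p))"
  have g': "(g has_derivative g' p) (at p)" for p
    using diff frechet_derivative_works unfolding g'_def by blast
  define G where "G = (\<lambda>l. g x - g (x - l *\<^sub>R z))"
  define G' where "G' = (\<lambda>l. grad2 g (x - l *\<^sub>R z) \<bullet> z)"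
  have G: "(G has_real_derivative G' l) (at l)" for l
  proof -
    have lin: "linear (g' p)" for p using g' has_derivative_linear by blast
    have "((\<lambda>l. x - l *\<^sub>R z) has_derivative (\<lambda>l. - (l *\<^sub>R z))) (at l)"
      by (auto intro!: derivative_eq_intros)
    from has_derivative_compose[OF this g']
    have "(G has_derivative (\<lambda>s. - g' (x - l *\<^sub>R z) (- (s *\<^sub>R z)))) (at l)"
      unfolding G_def by (auto intro!: derivative_eq_intros)
    then show ?thesis
      by (simp add: has_field_derivative_def G'_def grad2_inner[OF g'] linear_cmul[OF lin] linear_neg[OF lin] mult_commute_abs)
  qed
  have G0: "G l \<ge> 0" for l using max by (simp add: G_def)
  have gx: "grad2 g x = 0" using grad2_eq_0_at_max diff max by blast
  define n where "n = norm z"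
  have n: "n > 0" using z by (simp add: n_def)
  define Q where "Q = (\<lambda>l. l\<^sup>2 * n\<^sup>2 + (G l)\<^sup>2)"
  have Q: "Q l > 0" if "l > 0" for l
    using that n by (auto simp: Q_def intro!: add_pos_nonneg)
  define \<Psi> where "\<Psi> = (\<lambda>l. G l / sqrt (Q l))"
  define \<Psi>' where "\<Psi>' = (\<lambda>l. (l\<^sup>2 * n\<^sup>2 * G' l - l * n\<^sup>2 * G l) / (Q l) powr (3/2))"
  have powr32: "q powr (3/2) = q * sqrt q" if "q > 0" for q :: real
    using that powr_add[of q 1 "1/2"] by (simp add: powr_half_sqrt)
  have \<Psi>d: "(\<Psi> has_real_derivative \<Psi>' l) (at l)" if l: "l > 0" for l
  proof -
    have Qd: "(Q has_real_derivative (2 * l * n\<^sup>2 + 2 * G l * G' l)) (at l)"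
      unfolding Q_def by (auto intro!: derivative_eq_intros G)
    have sq: "sqrt (Q l) * sqrt (Q l) = Q l" "sqrt (Q l) > 0" using Q[OF l] by auto
    have "((\<lambda>l. sqrt (Q l)) has_real_derivative
        inverse (sqrt (Q l)) / 2 * (2 * l * n\<^sup>2 + 2 * G l * G' l)) (at l)"
      by (rule DERIV_chain2[OF DERIV_real_sqrt[OF Q[OF l]] Qd])
    from DERIV_divide[OF G this] sq(2)
    have "(\<Psi> has_real_derivative ((G' l * sqrt (Q l) - G l *
        (inverse (sqrt (Q l)) / 2 * (2 * l * n\<^sup>2 + 2 * G l * G' l))) / (sqrt (Q l) * sqrt (Q l)))) (at l)"
      unfolding \<Psi>_def by simp
    also have "(G' l * sqrt (Q l) - G l * (inverse (sqrt (Q l)) / 2 * (2 * l * n\<^sup>2 + 2 * G l * G' l)))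
        / (sqrt (Q l) * sqrt (Q l))
       = (G' l * (sqrt (Q l) * sqrt (Q l)) - G l * (l * n\<^sup>2 + G l * G' l)) / (Q l * sqrt (Q l))"
      unfolding sq(1) using sq(2) Q[OF l] by (simp add: divide_simps) (simp add: algebra_simps sq(1))
    \<comment> \<open>After inserting \<open>Q l\<close> in the numerator the two terms
      \<open>(G l)\<^sup>2 * G' l\<close> cancel.\<close>
    also have "\<dots> = \<Psi>' l"
      unfolding \<Psi>'_def powr32[OF Q[OF l]] sq(1)
      by (simp add: Q_def algebra_simps power2_eq_square)
    finally show ?thesis .
  qed
  have \<Psi>0: "\<Psi> 0 = 0" by (simp add: \<Psi>_def G_def)
  have \<Psi>pos: "\<Psi> l \<ge> 0" for l using G0 by (auto simp: \<Psi>_def Q_def)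
  have cont0: "(\<Psi> \<longlongrightarrow> 0) (at_right 0)"
  proof (rule tendsto_sandwich[where f = "\<lambda>_. 0" and h = "\<lambda>l. (G l / l) / n"])
    have "((\<lambda>l. (G l - G 0) / (l - 0)) \<longlongrightarrow> G' 0) (at 0)"
      using G[of 0] by (simp add: has_field_derivative_iff)
    then have "((\<lambda>l. G l / l) \<longlongrightarrow> 0) (at 0)" using gx by (simp add: G_def G'_def)
    then have "((\<lambda>l. (G l / l) / n) \<longlongrightarrow> 0 / n) (at 0)" by (intro tendsto_divide) (use n in auto)
    then show "((\<lambda>l. (G l / l) / n) \<longlongrightarrow> 0) (at_right 0)"
      by (simp add: filterlim_at_split)
    have "\<Psi> l \<le> (G l / l) / n" if "l > 0" for l
    proof -
      \<comment> \<open>Dropping \<open>(G l)\<^sup>2\<close> under the root bounds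
        \<open>\<Psi> l\<close> by \<open>(G l / l) / n\<close>, which tends to
        \<open>G' 0 / n = 0\<close>.\<close>
      have "l * n \<le> sqrt (Q l)" by (rule real_le_rsqrt) (simp add: Q_def power_mult_distrib)
      then have "G l / sqrt (Q l) \<le> G l / (l * n)"
        by (rule divide_left_mono) (use G0 that n Q[OF that] in auto)
      then show ?thesis by (simp add: \<Psi>_def)
    qed
    then show "\<forall>\<^sub>F l in at_right 0. \<Psi> l \<le> (G l / l) / n"
      by (auto simp: eventually_at_filter)
  qed (use \<Psi>pos in auto)
  have "continuous_on {0..b} \<Psi>"
    unfolding continuous_on_eq_continuous_within
  proof
    fix l assume l: "l \<in> {0..b}"
    show "continuous (at l within {0..b}) \<Psi>"
    proof (cases "l = 0")
      case True
      have "at 0 within {0..b} \<le> at_right (0::real)"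
        unfolding at_within_def by (intro inf_mono) auto
      with cont0 True \<Psi>0 show ?thesis
        unfolding continuous_within by (simp add: tendsto_mono)
    next
      case False
      then have "l > 0" using l by auto
      then show ?thesis
        by (rule continuous_at_imp_continuous_at_within[OF DERIV_isCont[OF \<Psi>d]])
    qed
  qed
  then have "(\<Psi>' has_integral (\<Psi> b - \<Psi> 0)) {0..b}"
  proof (rule fundamental_theorem_of_calculus_interior[OF \<open>b \<ge> 0\<close>])
    show "(\<Psi> has_vector_derivative \<Psi>' l) (at l)" if "l \<in> {0<..<b}" for l
      using \<Psi>d[of l] that by (simp add: has_real_derivative_iff_has_vector_derivative)
  qed
  then have int: "((\<lambda>l. (-1 / n\<^sup>2) * \<Psi>' l) has_integral (-1 / n\<^sup>2) * (\<Psi> b - \<Psi> 0)) {0..b}"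
    by (rule has_integral_mult_right)
  have le: "l * kernel g x (l *\<^sub>R z) \<le> (-1 / n\<^sup>2) * \<Psi>' l" if "l \<in> {0..b}" for l
  proof -
    have k: "kernel g x (l *\<^sub>R z) = - (l * G' l) / Q l powr (3/2)"
      by (simp add: kernel_def gx Q_def G_def G'_def n_def power_mult_distrib)
    have "(-1 / n\<^sup>2) * \<Psi>' l = l * (- (l * G' l) / Q l powr (3/2)) + l * G l / Q l powr (3/2)"
    proof -
      have *: "(-1 / m) * ((m * (p - q)) / S) = q / S - p / S" if "m \<noteq> 0" for m p q S :: real
        using that by (simp add: diff_divide_distrib)
      have "l\<^sup>2 * n\<^sup>2 * G' l - l * n\<^sup>2 * G l = n\<^sup>2 * (l * (l * G' l) - l * G l)"
        by (simp add: algebra_simps power2_eq_square)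
      then have "(-1 / n\<^sup>2) * \<Psi>' l = l * G l / Q l powr (3/2) - l * (l * G' l) / Q l powr (3/2)"
        unfolding \<Psi>'_def using n *[of "n\<^sup>2"] by simp
      then show ?thesis by simp
    qed
    \<comment> \<open>Maximality of \<open>x\<close> enters here: the dropped term is nonnegative
      because \<open>G l \<ge> 0\<close>.\<close>
    moreover have "l * G l / Q l powr (3/2) \<ge> 0" using that G0 by auto
    ultimately show ?thesis unfolding k by linarith
  qed
  have "I \<le> (-1 / n\<^sup>2) * (\<Psi> b - \<Psi> 0)"
    by (rule has_integral_le[OF hi int le])
  also have "\<dots> \<le> 0" using \<Psi>0 \<Psi>pos[of b] by simp
  finally show ?thesis .
qed

lemma kernel_integral_nonpos:
  fixes g :: "real \<times> real \<Rightarrow> real"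
  assumes diff: "\<And>p. g differentiable (at p)" and max: "\<And>y. g y \<le> g x"
    and int: "set_integrable lborel (cball 0 R) (kernel g x)"
  shows "(LINT y:cball 0 R|lborel. kernel g x y) \<le> 0"
  unfolding set_lebesgue_integral_def
proof (rule integral_nonpos_if_nonpos_on_rays)
  show "integrable lborel (\<lambda>y. indicat_real (cball 0 R) y *\<^sub>R kernel g x y)"
    using int by (simp add: set_integrable_def)
next
  fix z :: "real \<times> real" assume z: "z \<noteq> 0"
  define h where "h = (\<lambda>l. indicator {0<..} l * (l * (indicat_real (cball 0 R) (l *\<^sub>R z) *\<^sub>R kernel g x (l *\<^sub>R z))))"
  show "(\<integral>l. indicator {0<..} l * (l * (indicat_real (cball 0 R) (l *\<^sub>R z) *\<^sub>R kernel g x (l *\<^sub>R z))) \<partial>lborel) \<le> 0"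
    unfolding h_def[symmetric]
  \<comment> \<open>Integrability over the ball need not pass to each single ray. A nonintegrable
    ray has integral 0 by convention and so satisfies the bound; for \<open>R < 0\<close> the ball
    is empty.\<close>
  proof (cases "integrable lborel h \<and> R \<ge> 0")
    case True
    \<comment> \<open>The factor \<open>l\<close> vanishes at 0, so the endpoint may be
      included.\<close>
    have h: "h = (\<lambda>l. indicator {0..R / norm z} l *\<^sub>R (l * kernel g x (l *\<^sub>R z)))"
      using z by (auto simp: h_def fun_eq_iff field_simps split: split_indicator)
    then have si: "set_integrable lborel {0..R / norm z} (\<lambda>l. l * kernel g x (l *\<^sub>R z))"
      using True by (simp add: set_integrable_def)
    have "((\<lambda>l. l * kernel g x (l *\<^sub>R z)) has_integral
        (LINT l:{0..R / norm z}|lborel. l * kernel g x (l *\<^sub>R z))) {0..R / norm z}"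
      using set_borel_integral_eq_integral[OF si] by (simp add: has_integral_integrable_integral)
    from kernel_ray_integral_nonpos[OF diff max z _ this] True show "integral\<^sup>L lborel h \<le> 0"
      by (simp add: h set_lebesgue_integral_def)
  next
    case False
    then consider "\<not> integrable lborel h" | "R < 0" by linarith
    then show "integral\<^sup>L lborel h \<le> 0"
    proof cases
      case 2
      then have "h = (\<lambda>_. 0)" by (simp add: h_def)
      then show ?thesis by simp
    qed (simp add: not_integrable_integral_eq)
  qed
qed

lemma has_PV_kernel_nonpos:
  assumes "\<And>p. g differentiable (at p)" "\<And>y. g y \<le> g x" "has_PV (kernel g x) v"
  shows "v \<le> 0"
proof (rule tendsto_upperbound)
  show "((\<lambda>R. LINT y:cball 0 R|lborel. kernel g x y) \<longlongrightarrow> v) at_top"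
    using assms(3) by (simp add: has_PV_def)
  show "\<forall>\<^sub>F R in at_top. (LINT y:cball 0 R|lborel. kernel g x y) \<le> 0"
    using assms(3) by (intro always_eventually allI kernel_integral_nonpos assms(1,2))
      (simp add: has_PV_def)
qed simp

text \<open>The kernel is odd in \<open>g\<close>, so minima of \<open>g\<close> can be treated as
  maxima of \<open>- g\<close>; differentiability lets \<open>deriv\<close> commute with the
  sign.\<close>

lemma kernel_uminus:
  assumes "\<And>p. g differentiable (at p)"
  shows "kernel (\<lambda>y. - g y) x y = - kernel g x y"
proof -
  have "(\<lambda>s. g (p + s *\<^sub>R axis2 i)) differentiable (at 0)" for p i
    using differentiable_chain_at[of "\<lambda>s::real. p + s *\<^sub>R axis2 i" 0 g] assms
    by (simp add: o_def)
  then have "pd i (\<lambda>y. - g y) p = - pd i g p" for i p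
    unfolding pd_def by (intro deriv_minus) (simp add: field_differentiable_def real_differentiable_def)
  then have "grad2 (\<lambda>y. - g y) p = - grad2 g p" for p by (simp add: grad2_def)
  then show ?thesis
    by (simp add: kernel_def power2_commute inner_diff_left minus_divide_left)
qed

lemma has_PV_kernel_nonneg:
  assumes "\<And>p. g differentiable (at p)" "\<And>y. g x \<le> g y" "has_PV (kernel g x) v"
  shows "0 \<le> v"
proof -
  have k: "kernel (\<lambda>y. - g y) x = (\<lambda>y. - kernel g x y)"
    using kernel_uminus[OF assms(1)] by blast
  have "has_PV (kernel (\<lambda>y. - g y) x) (- v)"
    unfolding k has_PV_def
    using assms(3)[unfolded has_PV_def]
    by (auto simp: set_lebesgue_integral_def set_integrable_def intro: tendsto_minus)
  then have "- v \<le> 0"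
    by (rule has_PV_kernel_nonpos[rotated 2]) (use assms in auto)
  then show ?thesis by simp
qed

section \<open>The maximum principle\<close>

text \<open>The slope \<epsilon> of the barrier \<open>K + \<epsilon> * (1 + t)\<close> is what
  contradicts the weak sign \<open>d \<le> 0\<close>. The bound \<open>lip\<close> makes the infimum
  of the bad times a bad time, and \<open>att\<close> may be restricted to positive values because
  with \<open>K \<ge> 0\<close> the barrier is positive.\<close>

lemma maximum_principle:
  fixes f :: "real \<Rightarrow> 'a \<Rightarrow> real"
  assumes lip: "\<And>t. t \<in> {0..T} \<Longrightarrow> \<exists>C \<delta>. 0 < \<delta> \<and>
      (\<forall>s\<in>{0..T}. \<bar>s - t\<bar> < \<delta> \<longrightarrow> (\<forall>x. \<bar>f s x - f t x\<bar> \<le> C * \<bar>s - t\<bar>))"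
    and att: "\<And>t x0. t \<in> {0..T} \<Longrightarrow> f t x0 > 0 \<Longrightarrow> \<exists>x. \<forall>y. f t y \<le> f t x"
    and der: "\<And>t x. t \<in> {0..T} \<Longrightarrow> (\<And>y. f t y \<le> f t x) \<Longrightarrow>
      \<exists>d\<le>0. ((\<lambda>s. f s x) has_real_derivative d) (at t within {0..T})"
    and init: "\<And>x. f 0 x \<le> K" and "K \<ge> 0" and t: "t \<in> {0..T}"
  shows "f t x \<le> K"
proof (rule field_le_epsilon, rule ccontr)
  fix e :: real assume "e > 0" and "\<not> f t x \<le> K + e"
  \<comment> \<open>Normalised so that the barrier exceeds \<open>K\<close> by at most
    \<open>e\<close> on all of \<open>{0..T}\<close>.\<close>
  define \<epsilon> where "\<epsilon> = e / (1 + T)"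
  have "T \<ge> 0" using t by simp
  have \<epsilon>: "\<epsilon> > 0" using \<open>e > 0\<close> \<open>T \<ge> 0\<close> by (simp add: \<epsilon>_def)
  have "\<epsilon> * (1 + t) \<le> \<epsilon> * (1 + T)" using \<epsilon> t by simp
  also have "\<dots> = e" using \<open>T \<ge> 0\<close> by (simp add: \<epsilon>_def)
  finally have "f t x \<ge> K + \<epsilon> * (1 + t)" using \<open>\<not> f t x \<le> K + e\<close> by linarith
  define S where "S = {s \<in> {0..T}. \<exists>x. f s x \<ge> K + \<epsilon> * (1 + s)}"
  have "t \<in> S" using t \<open>f t x \<ge> K + \<epsilon> * (1 + t)\<close> by (auto simp: S_def)
  have bdd: "bdd_below S" by (rule bdd_belowI[of _ 0]) (auto simp: S_def)
  define \<tau> where "\<tau> = Inf S"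
  have lower: "\<tau> \<le> s" if "s \<in> S" for s unfolding \<tau>_def by (rule cInf_lower[OF that bdd])
  have "0 \<le> \<tau>" unfolding \<tau>_def by (rule cInf_greatest) (use \<open>t \<in> S\<close> in \<open>auto simp: S_def\<close>)
  then have \<tau>: "\<tau> \<in> {0..T}" using lower[OF \<open>t \<in> S\<close>] t by auto
  obtain C \<delta> where C: "\<delta> > 0" "\<And>s x. s \<in> {0..T} \<Longrightarrow> \<bar>s - \<tau>\<bar> < \<delta> \<Longrightarrow> \<bar>f s x - f \<tau> x\<bar> \<le> C * \<bar>s - \<tau>\<bar>"
    using lip[OF \<tau>] by blast
  \<comment> \<open>Bad times \<open>s \<ge> \<tau>\<close> come arbitrarily close to \<tau>, but
    the bad point moves with \<open>s\<close>; uniformity of the Lipschitz bound in \<open>x\<close>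
    is what allows the comparison at \<tau>.\<close>
  have approx: "\<exists>x. f \<tau> x \<ge> K + \<epsilon> * (1 + \<tau>) - \<eta>" if "\<eta> > 0" for \<eta>
  proof -
    \<comment> \<open>\<open>\<bar>C\<bar> + 1\<close> is a positive Lipschitz constant whatever the
      sign of \<open>C\<close>.\<close>
    have "\<tau> < \<tau> + min \<delta> (\<eta> / (\<bar>C\<bar> + 1))" using C(1) that by simp
    then obtain s where s: "s \<in> S" "s < \<tau> + min \<delta> (\<eta> / (\<bar>C\<bar> + 1))"
      using cInf_lessD[of S] \<open>t \<in> S\<close> unfolding \<tau>_def by blast
    then obtain x where x: "f s x \<ge> K + \<epsilon> * (1 + s)" "s \<in> {0..T}" by (auto simp: S_def)
    have "\<tau> \<le> s" using lower s by blast
    have "\<bar>f s x - f \<tau> x\<bar> \<le> C * \<bar>s - \<tau>\<bar>" using C(2)[of s x] s x \<open>\<tau> \<le> s\<close> by auto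
    also have "\<dots> \<le> (\<bar>C\<bar> + 1) * (s - \<tau>)" using \<open>\<tau> \<le> s\<close> by (simp add: mult_right_mono)
    also have "\<dots> \<le> (\<bar>C\<bar> + 1) * (\<eta> / (\<bar>C\<bar> + 1))" using s by (intro mult_left_mono) auto
    also have "\<dots> = \<eta>" by (simp add: add_nonneg_eq_0_iff)
    finally have "f \<tau> x \<ge> f s x - \<eta>" by linarith
    moreover have "\<epsilon> * (1 + \<tau>) \<le> \<epsilon> * (1 + s)" using \<epsilon> \<open>\<tau> \<le> s\<close> by simp
    ultimately show ?thesis using x(1) by (intro exI[of _ x]) linarith
  qed
  have "\<epsilon> * \<tau> \<ge> 0" using \<epsilon> \<tau> by simp
  obtain x0 where "f \<tau> x0 \<ge> K + \<epsilon> * (1 + \<tau>) - \<epsilon> / 2" using approx[of "\<epsilon> / 2"] \<epsilon> by auto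
  then have "f \<tau> x0 > 0" using \<open>K \<ge> 0\<close> \<open>\<epsilon> * \<tau> \<ge> 0\<close> \<epsilon> by (simp add: algebra_simps)
  then obtain m where m: "\<And>y. f \<tau> y \<le> f \<tau> m" using att[OF \<tau>] by blast
  have fm: "K + \<epsilon> * (1 + \<tau>) \<le> f \<tau> m"
  proof (rule field_le_epsilon)
    fix \<eta> :: real assume "\<eta> > 0"
    then obtain x where "f \<tau> x \<ge> K + \<epsilon> * (1 + \<tau>) - \<eta>" using approx by blast
    then show "K + \<epsilon> * (1 + \<tau>) \<le> f \<tau> m + \<eta>" using m[of x] by linarith
  qed
  \<comment> \<open>At time 0 the barrier is \<open>K + \<epsilon>\<close>, strictly above the
    initial values.\<close>
  have "\<tau> \<noteq> 0" using fm init[of m] \<epsilon> by (auto simp: algebra_simps)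
  then have "\<tau> > 0" using \<tau> by simp
  obtain d where d: "d \<le> 0" "((\<lambda>s. f s m) has_real_derivative d) (at \<tau> within {0..T})"
    using der[OF \<tau> m] by blast
  have "((\<lambda>s. f s m) has_real_derivative d) (at \<tau> within {0..\<tau>})"
    by (rule DERIV_subset[OF d(2)]) (use \<tau> in auto)
  then have lim: "((\<lambda>s. (f s m - f \<tau> m) / (s - \<tau>)) \<longlongrightarrow> d) (at_left \<tau>)"
    using \<open>\<tau> > 0\<close> by (simp add: has_field_derivative_iff at_within_Icc_at_left)
  \<comment> \<open>Before \<tau> the value at \<open>m\<close> is under the barrier, at \<tau> it
    is on or above it, so left difference quotients are at least the slope of the barrier.\<close>
  have "\<epsilon> \<le> (f s m - f \<tau> m) / (s - \<tau>)" if "s \<in> {0<..<\<tau>}" for s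
  proof -
    have "s \<notin> S" using lower[of s] that by auto
    then have "f s m < K + \<epsilon> * (1 + s)" using that \<tau> by (auto simp: S_def not_le)
    then have "f s m - f \<tau> m \<le> \<epsilon> * (s - \<tau>)" using fm by (simp add: algebra_simps)
    then show ?thesis using that by (simp add: neg_le_divide_eq)
  qed
  then have "\<forall>\<^sub>F s in at_left \<tau>. \<epsilon> \<le> (f s m - f \<tau> m) / (s - \<tau>)"
    using eventually_at_left_real[OF \<open>\<tau> > 0\<close>] by (rule eventually_mono[rotated])
  then have "\<epsilon> \<le> d" by (rule tendsto_lowerbound[OF lim]) simp
  then show False using d(1) \<epsilon> by simp
qed

section \<open>From the essential supremum to a pointwise bound\<close>

lemma AE_lborel_ex_in_open:
  fixes U :: "'a::euclidean_space set"
  assumes "AE y in lborel. P y" "open U" "U \<noteq> {}"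
  shows "\<exists>y\<in>U. P y"
proof (rule ccontr)
  assume *: "\<not> (\<exists>y\<in>U. P y)"
  from assms(1) have "AE y in lborel. y \<notin> U" by eventually_elim (use * in blast)
  then have "U \<in> null_sets lborel"
    using assms(2) by (simp add: AE_iff_null_sets)
  then have "negligible U" by (simp add: negligible_iff_null_sets null_sets_completionI)
  with open_not_negligible assms show False by blast
qed

text \<open>This is how an almost-everywhere bound on the square reaches its boundary points: each
  of their open neighbourhoods contains an open piece of the square.\<close>

lemma dom_set_subset_closure_interior: "dom_set D \<subseteq> closure (interior (dom_set D))"
proof (cases D)
  case Torus
  have "dom_set D = cbox (0, 0) (2 * pi, 2 * pi)"
    using Torus by (simp add: dom_set_def cbox_Pair_eq)
  moreover have "box (0, 0) (2 * pi, 2 * pi) \<noteq> {}"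
    by (auto simp: box_ne_empty Basis_prod_def)
  ultimately show ?thesis by (simp add: closure_box)
qed (simp add: dom_set_def)

text \<open>The datum \<open>g0\<close> agrees with the continuous \<open>g\<close> only almost
  everywhere, but a value of \<open>\<bar>g\<bar>\<close> above the essential supremum would persist
  on a nonempty open part of the domain, which is not a null set.\<close>

lemma Linf_norm_pointwise_bound:
  assumes g: "AE x in lborel. g x = g0 x" and adm: "admissible D g"
    and cont: "continuous_on UNIV g" and fin: "Linf_norm D g0 \<noteq> \<infinity>"
  obtains K where "Linf_norm D g0 = ereal K" "K \<ge> 0" "\<And>x. \<bar>g x\<bar> \<le> K"
proof -
  have "AE x in restrict_space lborel (dom_set D). ereal \<bar>g0 x\<bar> \<le> Linf_norm D g0"
    unfolding Linf_norm_def by (rule esssup_AE)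
  then have "AE x in lborel. x \<in> dom_set D \<longrightarrow> ereal \<bar>g0 x\<bar> \<le> Linf_norm D g0"
    by (subst (asm) AE_restrict_space_iff) auto
  with g have ae: "AE x in lborel. x \<in> dom_set D \<longrightarrow> ereal \<bar>g x\<bar> \<le> Linf_norm D g0"
    by eventually_elim simp
  have *: "\<exists>y\<in>U. ereal \<bar>g y\<bar> \<le> Linf_norm D g0" if "open U" "x \<in> U" "x \<in> dom_set D" for U x
  proof -
    have "U \<inter> interior (dom_set D) \<noteq> {}"
      using that dom_set_subset_closure_interior[of D] open_Int_closure_eq_empty[OF that(1)] by blast
    then have "\<exists>y\<in>U \<inter> interior (dom_set D). y \<in> dom_set D \<longrightarrow> ereal \<bar>g y\<bar> \<le> Linf_norm D g0"
      using that(1) by (intro AE_lborel_ex_in_open[OF ae] open_Int open_interior)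
    then show ?thesis using interior_subset by blast
  qed
  have zero: "0 \<in> dom_set D" by (cases D) (auto simp: dom_set_def zero_prod_def)
  \<comment> \<open>One point satisfying the bound makes the essential supremum nonnegative, as
    \<open>maximum_principle\<close> requires of \<open>K\<close>.\<close>
  obtain y where "ereal \<bar>g y\<bar> \<le> Linf_norm D g0" using *[of UNIV 0] zero by auto
  then have "0 \<le> Linf_norm D g0" using order_trans[of 0 "ereal \<bar>g y\<bar>"] by simp
  then obtain K where K: "Linf_norm D g0 = ereal K" "K \<ge> 0"
    using fin by (cases "Linf_norm D g0") auto
  have dom: "\<bar>g x\<bar> \<le> K" if "x \<in> dom_set D" for x
  proof (rule ccontr)
    assume "\<not> \<bar>g x\<bar> \<le> K"
    moreover have "open {y. K < \<bar>g y\<bar>}"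
      by (intro open_Collect_less continuous_intros cont)
    ultimately show False using *[of "{y. K < \<bar>g y\<bar>}" x] that K by auto
  qed
  have "\<bar>g x\<bar> \<le> K" for x
  proof -
    obtain y s u where y: "g y = g x" "quadrant_box y s u \<subseteq> dom_set D"
      using representative_with_box[of D x] adm by blast
    have "y \<in> quadrant_box y s u" by (cases y) (simp add: quadrant_box_def side_def)
    then show ?thesis using dom[of y] y by auto
  qed
  with K that show thesis by blast
qed

theorem theorem4p1:
  fixes D :: domain and k :: nat and \<rho>1 \<rho>2 T :: real
    and f0 :: "real \<times> real \<Rightarrow> real" and f :: "real \<Rightarrow> real \<times> real \<Rightarrow> real"
  assumes "k \<ge> 4"
    and "0 \<le> \<rho>1" and "\<rho>1 < \<rho>2"
    and "in_Hk D k f0"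
    and "C1_Hk D k T f"
    and "interface_solution \<rho>1 \<rho>2 T f"
    and "AE x in lborel. f 0 x = f0 x"
  shows "\<forall>t\<in>{0..T}. Linf_norm D (f t) \<le> Linf_norm D f0"
proof
  fix t assume t: "t \<in> {0..T}"
  have diff: "f s differentiable (at x)" if "s \<in> {0..T}" for s x
    using assms(6) that unfolding interface_solution_def by blast
  have cont: "continuous_on UNIV (f s)" if "s \<in> {0..T}" for s
    using diff[OF that] by (intro continuous_at_imp_continuous_on) (auto intro: differentiable_imp_continuous_within)
  have Hk: "in_Hk D k (f s)" if "s \<in> {0..T}" for s
    using assms(5) that by (simp add: C1_Hk_def)
  have k: "k \<ge> 2" using assms(1) by simp
  define c where "c = (\<rho>2 - \<rho>1) / (4 * pi)"
  have c: "c \<ge> 0" using assms(3) by (simp add: c_def)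
  have eqn: "\<exists>v. has_PV (kernel (f s) x) v \<and> ((\<lambda>s. f s x) has_real_derivative (c * v)) (at s within {0..T})"
    if "s \<in> {0..T}" for s x
    using assms(6) that unfolding interface_solution_def c_def by blast
  show "Linf_norm D (f t) \<le> Linf_norm D f0"
  proof (cases "Linf_norm D f0 = \<infinity>")
    case False
    have 0: "0 \<in> {0..T}" using t by simp
    have "admissible D (f 0)" using Hk[OF 0] by (simp add: in_Hk_def)
    then obtain K where K: "Linf_norm D f0 = ereal K" "K \<ge> 0" "\<And>x. \<bar>f 0 x\<bar> \<le> K"
      using Linf_norm_pointwise_bound[OF assms(7) _ cont[OF 0] False] by blast
    note lip = C1_Hk_locally_lipschitz[OF assms(5) k _ cont]
    have "f t x \<le> K" for x
    proof (rule maximum_principle[OF lip])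
      show "\<exists>x. \<forall>y. f s y \<le> f s x" if "s \<in> {0..T}" "f s x0 > 0" for s x0
        by (rule in_Hk_attains_positive_max[OF Hk k cont]) (use that in auto)
      show "\<exists>d\<le>0. ((\<lambda>s. f s x) has_real_derivative d) (at s within {0..T})"
        if s: "s \<in> {0..T}" and max: "\<And>y. f s y \<le> f s x" for s x
      proof -
        obtain v where v: "has_PV (kernel (f s) x) v"
          "((\<lambda>s. f s x) has_real_derivative (c * v)) (at s within {0..T})"
          using eqn[OF s] by blast
        have "c * v \<le> 0"
          using has_PV_kernel_nonpos[OF diff[OF s] max v(1)] c by (simp add: mult_nonneg_nonpos)
        with v(2) show ?thesis by blast
      qed
      show "f 0 x \<le> K" for x using K(3)[of x] by simp
    qed (use K t in auto)
    \<comment> \<open>Maxima of \<open>- f\<close> are minima of \<open>f\<close>, where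
      \<open>has_PV_kernel_nonneg\<close> supplies the sign.\<close>
    moreover have "- f t x \<le> K" for x
    proof (rule maximum_principle[where f = "\<lambda>s x. - f s x"])
      show "\<exists>C \<delta>. 0 < \<delta> \<and> (\<forall>r\<in>{0..T}. \<bar>r - s\<bar> < \<delta> \<longrightarrow> (\<forall>x. \<bar>- f r x - - f s x\<bar> \<le> C * \<bar>r - s\<bar>))"
        if "s \<in> {0..T}" for s
        using lip[OF that] by (simp add: abs_minus_commute)
      show "\<exists>x. \<forall>y. - f s y \<le> - f s x" if s: "s \<in> {0..T}" and "- f s x0 > 0" for s x0
      proof (rule in_Hk_attains_positive_max[OF _ k])
        show "in_Hk D k (\<lambda>x. - f s x)" using in_Hk_lincomb[OF Hk[OF s] Hk[OF s], of "-1" 0] by simp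
        show "continuous_on UNIV (\<lambda>x. - f s x)" by (intro continuous_intros cont s)
      qed (use that in auto)
      show "\<exists>d\<le>0. ((\<lambda>s. - f s x) has_real_derivative d) (at s within {0..T})"
        if s: "s \<in> {0..T}" and min: "\<And>y. - f s y \<le> - f s x" for s x
      proof -
        obtain v where v: "has_PV (kernel (f s) x) v"
          "((\<lambda>s. f s x) has_real_derivative (c * v)) (at s within {0..T})"
          using eqn[OF s] by blast
        have "0 \<le> c * v"
          using has_PV_kernel_nonneg[OF diff[OF s] _ v(1)] min c by simp
        with DERIV_minus[OF v(2)] show ?thesis by (intro exI[of _ "- (c * v)"]) simp
      qed
      show "- f 0 x \<le> K" for x using K(3)[of x] by simp
    qed (use K t in auto)
    ultimately have bound: "\<bar>f t x\<bar> \<le> K" for x by (simp add: abs_le_iff)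
    have [measurable]: "f t \<in> borel_measurable borel"
      by (rule borel_measurable_continuous_onI[OF cont[OF t]])
    have "Linf_norm D (f t) \<le> ereal K"
      unfolding Linf_norm_def
      by (rule esssup_I) (auto intro!: measurable_restrict_space1 AE_I2 simp: bound)
    then show ?thesis by (simp add: K)
  qed simp
qed

end
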